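(* Let $F$ be a graph such that $\mathrm{ex}(n,K_3,F)=o(n^2)$. Then $\mathrm{th}(F)\le (\chi(F)-1)(|V(F)|-1)+1$.
   Context: $\mathrm{ex}(n,H,F)$ (generalized Turán number) is the maximum number of copies of $H$ in an $F$-free $n$-vertex graph; asymptotics are as $n\to\infty$. A hypergraph $\mathcal{H}$ is a Berge copy of a graph $G$ if $V(G)\subseteq V(\mathcal{H})$ and there is a bijection $f:E(G)\to E(\mathcal{H})$ with $e\subseteq f(e)$ for all $e\in E(G)$. $\mathrm{ex}_r(n,\text{Berge-}F)$ is the maximum number of hyperedges in an $r$-uniform $n$-vertex hypergraph with no Berge copy of $F$. For every $F$ there is $r_0$ with $\mathrm{ex}_r(n,\text{Berge-}F)=o(n^2)$ for all $r\ge r_0$; the uniformity threshold $\mathrm{th}(F)$ is the smallest such $r_0$. $\chi(F)$ is the chromatic number of $F$. *)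

theory Defs
  imports Main "HOL-Library.Landau_Symbols"
begin

definition graph_on :: "'a set \<Rightarrow> 'a set set \<Rightarrow> bool" where
  "graph_on V E \<longleftrightarrow> finite V \<and> (\<forall>e\<in>E. e \<subseteq> V \<and> card e = 2)"

definition host_graph :: "nat \<Rightarrow> nat set set \<Rightarrow> bool" where
  "host_graph n G \<longleftrightarrow> (\<forall>e\<in>G. e \<subseteq> {..<n} \<and> card e = 2)"

definition contains_copy :: "'a set \<Rightarrow> 'a set set \<Rightarrow> nat \<Rightarrow> nat set set \<Rightarrow> bool" where
  "contains_copy V E n G \<longleftrightarrow>
     (\<exists>\<phi>. inj_on \<phi> V \<and> \<phi> ` V \<subseteq> {..<n} \<and> (\<forall>e\<in>E. \<phi> ` e \<in> G))"

definition triangles :: "nat \<Rightarrow> nat set set \<Rightarrow> nat" where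
  "triangles n G = card {T. T \<subseteq> {..<n} \<and> card T = 3 \<and>
                            (\<forall>x\<in>T. \<forall>y\<in>T. x \<noteq> y \<longrightarrow> {x, y} \<in> G)}"

definition ex_K3 :: "'a set \<Rightarrow> 'a set set \<Rightarrow> nat \<Rightarrow> nat" where
  "ex_K3 V E n = Sup {triangles n G | G. host_graph n G \<and> \<not> contains_copy V E n G}"

definition uniform_hypergraph :: "nat \<Rightarrow> nat \<Rightarrow> nat set set \<Rightarrow> bool" where
  "uniform_hypergraph r n H \<longleftrightarrow> (\<forall>h\<in>H. h \<subseteq> {..<n} \<and> card h = r)"

definition contains_berge :: "'a set \<Rightarrow> 'a set set \<Rightarrow> nat \<Rightarrow> nat set set \<Rightarrow> bool" where
  "contains_berge V E n H \<longleftrightarrow>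
     (\<exists>\<phi> f. inj_on \<phi> V \<and> \<phi> ` V \<subseteq> {..<n} \<and> inj_on f E \<and>
            (\<forall>e\<in>E. f e \<in> H \<and> \<phi> ` e \<subseteq> f e))"

definition ex_berge :: "'a set \<Rightarrow> 'a set set \<Rightarrow> nat \<Rightarrow> nat \<Rightarrow> nat" where
  "ex_berge V E r n =
     Sup {card H | H. uniform_hypergraph r n H \<and> \<not> contains_berge V E n H}"

definition threshold :: "'a set \<Rightarrow> 'a set set \<Rightarrow> nat" where
  "threshold V E = (LEAST r0. \<forall>r\<ge>r0. (\<lambda>n. real (ex_berge V E r n)) \<in> o(\<lambda>n. real n ^ 2))"

definition chromatic_number :: "'a set \<Rightarrow> 'a set set \<Rightarrow> nat" where
  "chromatic_number V E = (LEAST k. \<exists>c :: 'a \<Rightarrow> nat. (\<forall>v\<in>V. c v < k) \<and>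
       (\<forall>e\<in>E. \<forall>u\<in>e. \<forall>v\<in>e. u \<noteq> v \<longrightarrow> c u \<noteq> c v))"

end

theory Submission
  imports Defs "HOL-Analysis.Convex" "HOL-Library.Indicator_Function" "HOL-Library.FuncSet"
begin

text \<open>
  Let \<open>H\<close> be an \<open>r\<close>-uniform hypergraph without a Berge copy of \<open>F\<close>, and call a pair heavy if it lies in
  at least \<open>|E(F)|\<close> hyperedges. If \<open>L\<close> is a set of pairs with distinct hyperedges containing them, then
  the heavy pairs together with \<open>L\<close> form an \<open>F\<close>-free graph, because the hyperedges for the heavy pairs
  can be chosen greedily. In particular no hyperedge contains a heavy clique of size \<open>|V(F)|\<close>.

  If \<open>F\<close> is bipartite, every hyperedge contains a light pair, and choosing one in each
  hyperedge gives an \<open>F\<close>-free graph with a constant proportion of \<open>|H|\<close> edges. So \<open>|H| = o(n\<^sup>2)\<close>.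

  If \<open>\<chi>(F) \<ge> 3\<close>, consider a hyperedge in which no light pair forms a triangle with two heavy pairs.
  There heaviness is an equivalence relation whose classes have at most \<open>|V(F)| - 1\<close> elements,
  so there are at least three classes and the hyperedge contains a triangle of light pairs.
  The hyperedges that do have such a mixed triangle give, up to a constant factor, as many distinct light
  pairs, each in a triangle of an \<open>F\<close>-free graph, so there are \<open>O(ex(n, K\<^sub>3, F))\<close> of them.
  The others give, up to a constant factor, as many edge-disjoint light triangles. Picking a random edge
  of each of them leaves an \<open>F\<close>-free graph, so their union has only \<open>O(n\<^sup>2 + ex(n, K\<^sub>3, F))\<close> triangles, and by the triangle removal lemma the number of
  the edge-disjoint triangles is \<open>o(n\<^sup>2)\<close>.
\<close>

subsection \<open>Regularity lemma\<close>

lemma sum_indicator_real: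
  "finite A \<Longrightarrow> (\<Sum>x\<in>A. indicator B x) = real (card (B \<inter> A))"
  by (simp add: indicator_def sum.If_cases Int_commute)

text \<open>The conditional expectation of \<open>g\<close> given \<open>l\<close>, under the
  uniform distribution on \<open>\<Omega>\<close>. Where no element of \<open>\<Omega>\<close> has
  the label of \<open>x\<close>, division by zero makes it 0.\<close>

definition cell_avg :: "'w set \<Rightarrow> ('w \<Rightarrow> 'b) \<Rightarrow> ('w \<Rightarrow> real) \<Rightarrow> 'w \<Rightarrow> real" where
  "cell_avg \<Omega> l g x = (\<Sum>y | y \<in> \<Omega> \<and> l y = l x. g y) / card {y \<in> \<Omega>. l y = l x}"

text \<open>After exchanging the two sums, each value \<open>g y\<close> is counted once for every
  \<open>x\<close> in the cell of \<open>y\<close>, with weight \<open>w y\<close> divided by the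
  size of that cell.\<close>

lemma sum_mult_cell_avg:
  assumes fin: "finite \<Omega>"
    and w: "\<And>x y. x \<in> \<Omega> \<Longrightarrow> y \<in> \<Omega> \<Longrightarrow> l x = l y \<Longrightarrow> w x = w y"
  shows "(\<Sum>x\<in>\<Omega>. w x * cell_avg \<Omega> l g x) = (\<Sum>x\<in>\<Omega>. w x * g x)"
proof -
  let ?c = "\<lambda>x. real (card {y \<in> \<Omega>. l y = l x})"
  have "(\<Sum>x\<in>\<Omega>. w x * cell_avg \<Omega> l g x)
      = (\<Sum>x\<in>\<Omega>. \<Sum>y\<in>\<Omega>. if l y = l x then w x * g y / ?c x else 0)"
    unfolding cell_avg_def
    by (intro sum.cong refl)
      (simp add: sum.inter_filter[OF fin, symmetric] sum_distrib_left sum_divide_distrib)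
  also have "\<dots> = (\<Sum>y\<in>\<Omega>. \<Sum>x\<in>\<Omega>. if l y = l x then w x * g y / ?c x else 0)"
    by (rule sum.swap)
  also have "\<dots> = (\<Sum>y\<in>\<Omega>. \<Sum>x\<in>\<Omega>. if l x = l y then w y * g y / ?c y else 0)"
    by (intro sum.cong refl) (auto dest: w)
  also have "\<dots> = (\<Sum>y\<in>\<Omega>. w y * g y)"
  proof (intro sum.cong refl)
    fix y assume y: "y \<in> \<Omega>"
    then have "?c y \<noteq> 0" using fin by auto
    then show "(\<Sum>x\<in>\<Omega>. if l x = l y then w y * g y / ?c y else 0) = w y * g y"
      by (simp add: sum.inter_filter[OF fin, symmetric])
  qed
  finally show ?thesis .
qed

lemma cell_avg_cong: "l x = l y \<Longrightarrow> cell_avg \<Omega> l g x = cell_avg \<Omega> l g y"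
  by (simp add: cell_avg_def)

lemma cell_avg_bounds:
  assumes "\<And>y. y \<in> \<Omega> \<Longrightarrow> 0 \<le> g y" "\<And>y. y \<in> \<Omega> \<Longrightarrow> g y \<le> 1"
  shows "0 \<le> cell_avg \<Omega> l g x" "cell_avg \<Omega> l g x \<le> 1"
proof -
  let ?C = "{y \<in> \<Omega>. l y = l x}"
  show "0 \<le> cell_avg \<Omega> l g x"
    unfolding cell_avg_def using assms by (intro divide_nonneg_nonneg sum_nonneg) auto
  have "sum g ?C \<le> (\<Sum>y\<in>?C. 1)" using assms by (intro sum_mono) auto
  then show "cell_avg \<Omega> l g x \<le> 1"
    unfolding cell_avg_def by (auto simp: divide_le_eq_1)
qed

text \<open>The change from the coarse average to the fine one is orthogonal to the coarse average,
  because both have the same inner product with it as \<open>g\<close> itself.\<close>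

lemma cell_avg_pythagoras:
  assumes fin: "finite \<Omega>"
    and ref: "\<And>x y. x \<in> \<Omega> \<Longrightarrow> y \<in> \<Omega> \<Longrightarrow> l' x = l' y \<Longrightarrow> l x = l y"
  shows "(\<Sum>x\<in>\<Omega>. (cell_avg \<Omega> l' g x)\<^sup>2) =
    (\<Sum>x\<in>\<Omega>. (cell_avg \<Omega> l g x)\<^sup>2) + (\<Sum>x\<in>\<Omega>. (cell_avg \<Omega> l' g x - cell_avg \<Omega> l g x)\<^sup>2)"
proof -
  let ?p = "cell_avg \<Omega> l g" and ?q = "cell_avg \<Omega> l' g"
  have "(\<Sum>x\<in>\<Omega>. ?p x * ?q x) = (\<Sum>x\<in>\<Omega>. ?p x * g x)"
    by (intro sum_mult_cell_avg fin) (metis ref cell_avg_cong)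
  also have "\<dots> = (\<Sum>x\<in>\<Omega>. ?p x * ?p x)"
    by (intro sum_mult_cell_avg[symmetric] fin) (metis cell_avg_cong)
  finally have "(\<Sum>x\<in>\<Omega>. ?p x * ?q x) = (\<Sum>x\<in>\<Omega>. ?p x * ?p x)" .
  moreover have "(\<Sum>x\<in>\<Omega>. (?q x - ?p x)\<^sup>2)
      = (\<Sum>x\<in>\<Omega>. (?q x)\<^sup>2) + (\<Sum>x\<in>\<Omega>. ?p x * ?p x) - 2 * (\<Sum>x\<in>\<Omega>. ?p x * ?q x)"
    by (simp add: power2_eq_square algebra_simps sum.distrib sum_subtractf sum_distrib_left)
  ultimately show ?thesis by (simp add: power2_eq_square)
qed

text \<open>A partition is represented by a family \<open>\<S>\<close> of sets, its parts being the atoms of \<open>\<S>\<close>, so that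
  refining a partition is just enlarging \<open>\<S>\<close>. No equitability is needed.\<close>

definition label :: "'a set set \<Rightarrow> 'a \<Rightarrow> 'a set set" where
  "label \<S> x = {S \<in> \<S>. x \<in> S}"

definition cell :: "'a set \<Rightarrow> 'a set set \<Rightarrow> 'a \<Rightarrow> 'a set" where
  "cell V \<S> x = {y \<in> V. label \<S> y = label \<S> x}"

definition density :: "('a \<times> 'a) set \<Rightarrow> 'a set \<Rightarrow> 'a set \<Rightarrow> real" where
  "density R A B = card (R \<inter> A \<times> B) / (card A * card B)"

text \<open>The comparison of densities is multiplied out by \<open>card X * card Y\<close>, which
  avoids a division. Strictness of the deviation forces both sets of a witness to be
  nonempty.\<close>

definition irregular_witness ::
  "('a \<times> 'a) set \<Rightarrow> real \<Rightarrow> 'a set \<Rightarrow> 'a set \<Rightarrow> 'a set \<Rightarrow> 'a set \<Rightarrow> bool" where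
  "irregular_witness R \<epsilon> A B X Y \<longleftrightarrow> X \<subseteq> A \<and> Y \<subseteq> B \<and>
     \<epsilon> * real (card A) \<le> card X \<and> \<epsilon> * real (card B) \<le> card Y \<and>
     \<epsilon> * real (card X * card Y) < \<bar>card (R \<inter> X \<times> Y) - density R A B * (card X * card Y)\<bar>"

definition irregular :: "('a \<times> 'a) set \<Rightarrow> real \<Rightarrow> 'a set \<Rightarrow> 'a set \<Rightarrow> bool" where
  "irregular R \<epsilon> A B \<longleftrightarrow> (\<exists>X Y. irregular_witness R \<epsilon> A B X Y)"

text \<open>Counting pairs of points weights each irregular pair of cells by the product of the two
  sizes, as is appropriate for cells of unequal size.\<close>

definition irregular_pairs where
  "irregular_pairs R V \<S> \<epsilon> =
     {(x, y) \<in> V \<times> V. irregular R \<epsilon> (cell V \<S> x) (cell V \<S> y)}"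

text \<open>The density between the cells of the two points, written as an average over
  \<open>V \<times> V\<close> so that \<open>cell_avg_pythagoras\<close> governs
  refinements.\<close>

definition cell_density :: "('a \<times> 'a) set \<Rightarrow> 'a set \<Rightarrow> 'a set set \<Rightarrow> 'a \<times> 'a \<Rightarrow> real" where
  "cell_density R V \<S> = cell_avg (V \<times> V) (map_prod (label \<S>) (label \<S>)) (indicator R)"

text \<open>The mean square density of Szemeredi's proof, left unnormalised: it ranges between 0 and
  \<open>(card V)^2\<close>.\<close>

definition energy where
  "energy R V \<S> = (\<Sum>p\<in>V \<times> V. (cell_density R V \<S> p)\<^sup>2)"

section \<open>Energy increment and regular partitions\<close>

lemma cell_density_eq:
  assumes "finite V" shows "cell_density R V \<S> (x, y) = density R (cell V \<S> x) (cell V \<S> y)"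
proof -
  have eq: "{p \<in> V \<times> V. map_prod (label \<S>) (label \<S>) p = map_prod (label \<S>) (label \<S>) (x, y)}
      = cell V \<S> x \<times> cell V \<S> y"
    by (auto simp: cell_def)
  have f: "finite (cell V \<S> x \<times> cell V \<S> y)" using assms by (auto simp: cell_def)
  show ?thesis
    unfolding cell_density_def cell_avg_def eq density_def
    using f by (simp add: sum_indicator_real card_cartesian_product)
qed

lemma cell_density_bounds: "0 \<le> cell_density R V \<S> p" "cell_density R V \<S> p \<le> 1"
  unfolding cell_density_def by (rule cell_avg_bounds; simp add: indicator_def)+

lemma energy_le: "energy R V \<S> \<le> (real (card V))\<^sup>2"
proof -
  have "energy R V \<S> \<le> (\<Sum>p\<in>V \<times> V. 1)"
    unfolding energy_def by (intro sum_mono) (auto simp: cell_density_bounds power_le_one)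
  then show ?thesis by (simp add: card_cartesian_product power2_eq_square)
qed

lemma energy_nonneg: "0 \<le> energy R V \<S>"
  unfolding energy_def by (simp add: sum_nonneg)

text \<open>The new densities sum over \<open>X \<times> Y\<close> to the true number of edges, the
  old ones to the expected number. Irregularity bounds the difference from below, Cauchy-Schwarz
  turns it into \<open>\<epsilon>^2 * card X * card Y\<close>, and the sizes of \<open>X\<close> and
  \<open>Y\<close> give the other two factors \<open>\<epsilon>\<close>.\<close>

lemma sum_sq_ge_irregular:
  assumes fin: "finite V" and \<epsilon>: "0 < \<epsilon>"
    and W: "irregular_witness R \<epsilon> A B X Y" and XY: "X \<in> \<S>'" "Y \<in> \<S>'"
    and A: "A = cell V \<S> a" and B: "B = cell V \<S> b"
  shows "\<epsilon> ^ 4 * (card A * card B)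
    \<le> (\<Sum>p\<in>A \<times> B. (cell_density R V \<S>' p - cell_density R V \<S> p)\<^sup>2)"
proof -
  let ?q = "cell_density R V \<S>'" and ?p = "cell_density R V \<S>" and ?d = "density R A B"
  from W have sX: "X \<subseteq> A" and sY: "Y \<subseteq> B"
    and cX: "\<epsilon> * card A \<le> card X" and cY: "\<epsilon> * card B \<le> card Y"
    and dev: "\<epsilon> * (card X * card Y) < \<bar>card (R \<inter> X \<times> Y) - ?d * (card X * card Y)\<bar>"
    by (auto simp: irregular_witness_def)
  have AV: "A \<subseteq> V" "B \<subseteq> V" using A B by (auto simp: cell_def)
  have finAB: "finite A" "finite B" using AV fin finite_subset by auto
  have XV: "X \<times> Y \<subseteq> V \<times> V" using sX sY AV by auto
  have memX: "x \<in> X \<longleftrightarrow> y \<in> X" if "label \<S>' x = label \<S>' y" for x y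
    using that XY by (auto simp: label_def)
  have memY: "x \<in> Y \<longleftrightarrow> y \<in> Y" if "label \<S>' x = label \<S>' y" for x y
    using that XY by (auto simp: label_def)
  have finXY: "finite (X \<times> Y)" using XV fin finite_subset by blast
  \<comment> \<open>As \<open>X\<close> and \<open>Y\<close> belong to \<open>\<S>'\<close>, the
    indicator of \<open>X \<times> Y\<close> is constant on the new cells, so it may serve as a
    weight in \<open>sum_mult_cell_avg\<close>.\<close>
  have "(\<Sum>p\<in>X \<times> Y. ?q p) = (\<Sum>p\<in>V \<times> V. indicator (X \<times> Y) p * ?q p)"
    using XV fin by (simp add: indicator_def sum.If_cases Int_absorb1 flip: sum.inter_restrict)
  also have "\<dots> = (\<Sum>p\<in>V \<times> V. indicator (X \<times> Y) p * indicator R p)"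
    unfolding cell_density_def
  proof (rule sum_mult_cell_avg)
    fix p q assume "map_prod (label \<S>') (label \<S>') p = map_prod (label \<S>') (label \<S>') q"
    then show "(indicator (X \<times> Y) p :: real) = indicator (X \<times> Y) q"
      by (cases p; cases q) (auto simp: indicator_def dest: memX memY)
  qed (use fin in auto)
  also have "\<dots> = (\<Sum>p\<in>V \<times> V. indicator (R \<inter> X \<times> Y) p)"
    by (intro sum.cong refl) (auto simp: indicator_def)
  also have "\<dots> = card (R \<inter> X \<times> Y)"
    using XV fin by (subst sum_indicator_real) (auto intro!: arg_cong[where f = card])
  finally have q: "(\<Sum>p\<in>X \<times> Y. ?q p) = card (R \<inter> X \<times> Y)" .
  have p: "?p z = ?d" if zXY: "z \<in> X \<times> Y" for z
  proof -
    obtain x y where z: "z = (x, y)" "x \<in> A" "y \<in> B" using zXY sX sY by auto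
    then have "cell V \<S> x = A" "cell V \<S> y = B" using A B by (auto simp: cell_def)
    then show ?thesis using z cell_density_eq[OF fin] by simp
  qed
  let ?N = "real (card X * card Y)"
  have s: "(\<Sum>p\<in>X \<times> Y. ?q p - ?p p) = card (R \<inter> X \<times> Y) - ?d * ?N"
    using p by (simp add: sum_subtractf q card_cartesian_product)
  have "?N > 0"
  proof (rule ccontr)
    assume "\<not> ?N > 0"
    then have "X \<times> Y = {}" using finXY by (metis card_cartesian_product card_eq_0_iff of_nat_0_less_iff gr0I)
    then have "R \<inter> X \<times> Y = {}" "?N = 0" by auto
    then show False using dev by auto
  qed
  have "(\<epsilon> * ?N)\<^sup>2 \<le> (\<Sum>p\<in>X \<times> Y. ?q p - ?p p)\<^sup>2"
    unfolding s using dev \<epsilon> by (intro abs_le_square_iff[THEN iffD1]) (simp add: abs_mult)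
  also have "\<dots> \<le> (\<Sum>p\<in>X \<times> Y. (?q p - ?p p)\<^sup>2) * ?N"
    using Cauchy_Schwarz_ineq_sum[of "\<lambda>p. ?q p - ?p p" "\<lambda>_. 1" "X \<times> Y"]
    by (simp add: card_cartesian_product)
  finally have "(\<epsilon>\<^sup>2 * ?N) * ?N \<le> (\<Sum>p\<in>X \<times> Y. (?q p - ?p p)\<^sup>2) * ?N"
    by (simp only: power2_eq_square mult_ac)
  then have "\<epsilon>\<^sup>2 * ?N \<le> (\<Sum>p\<in>X \<times> Y. (?q p - ?p p)\<^sup>2)"
    using \<open>?N > 0\<close> by (rule mult_right_le_imp_le)
  also have "\<dots> \<le> (\<Sum>p\<in>A \<times> B. (?q p - ?p p)\<^sup>2)"
    using sX sY finAB by (intro sum_mono2) auto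
  finally have 1: "\<epsilon>\<^sup>2 * ?N \<le> (\<Sum>p\<in>A \<times> B. (?q p - ?p p)\<^sup>2)" .
  have "(\<epsilon> * card A) * (\<epsilon> * card B) \<le> real (card X) * card Y"
    using cX cY \<epsilon> by (intro mult_mono) auto
  then have "\<epsilon>\<^sup>2 * ((\<epsilon> * card A) * (\<epsilon> * card B)) \<le> \<epsilon>\<^sup>2 * ?N"
    by (intro mult_left_mono) auto
  then show ?thesis using 1 by (simp add: power4_eq_xxxx power2_eq_square algebra_simps)
qed

lemma card_cells_le:
  assumes "finite \<S>" shows "finite (cell V \<S> ` V)" "card (cell V \<S> ` V) \<le> 2 ^ card \<S>"
proof -
  have sub: "cell V \<S> ` V \<subseteq> (\<lambda>L. {y \<in> V. label \<S> y = L}) ` Pow \<S>"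
    by (auto simp: cell_def label_def)
  have "finite (Pow \<S>)" using assms by simp
  then show "finite (cell V \<S> ` V)" by (meson sub finite_imageI finite_subset)
  have "card (cell V \<S> ` V) \<le> card ((\<lambda>L. {y \<in> V. label \<S> y = L}) ` Pow \<S>)"
    using assms sub by (intro card_mono) auto
  also have "\<dots> \<le> card (Pow \<S>)" using assms by (intro card_image_le) auto
  finally show "card (cell V \<S> ` V) \<le> 2 ^ card \<S>" using assms by (simp add: card_Pow)
qed

text \<open>A witness for every ordered pair of cells is added to the family at once. There are at
  most \<open>2 ^ card \<S>\<close> cells, and each pair adds two sets.\<close>

lemma energy_increment:
  assumes fin: "finite V" and \<epsilon>: "0 < \<epsilon>" and finS: "finite \<S>"
  shows "\<exists>\<S>'. finite \<S>' \<and> card \<S>' \<le> card \<S> + 2 * (2 ^ card \<S> * 2 ^ card \<S>) \<and>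
    energy R V \<S> + \<epsilon> ^ 4 * card (irregular_pairs R V \<S> \<epsilon>) \<le> energy R V \<S>'"
proof -
  define C where "C = cell V \<S> ` V"
  have finC: "finite C" "card C \<le> 2 ^ card \<S>" using card_cells_le[OF finS] by (auto simp: C_def)
  \<comment> \<open>For regular pairs the chosen sets are arbitrary; adding them as well does no
    harm, since refinement never lowers the energy.\<close>
  obtain WX WY where W: "\<And>A B. irregular R \<epsilon> A B \<Longrightarrow> irregular_witness R \<epsilon> A B (WX A B) (WY A B)"
    using that[of "\<lambda>A B. fst (SOME p. irregular_witness R \<epsilon> A B (fst p) (snd p))"
        "\<lambda>A B. snd (SOME p. irregular_witness R \<epsilon> A B (fst p) (snd p))"]
    by (metis (mono_tags, lifting) irregular_def fst_conv snd_conv someI)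
  define \<S>' where "\<S>' = \<S> \<union> (case_prod WX ` (C \<times> C) \<union> case_prod WY ` (C \<times> C))"
  have "card \<S>' \<le> card \<S> + (card (case_prod WX ` (C \<times> C)) + card (case_prod WY ` (C \<times> C)))"
    unfolding \<S>'_def by (meson card_Un_le le_trans add_left_mono)
  also have "\<dots> \<le> card \<S> + (card (C \<times> C) + card (C \<times> C))"
    using finC by (intro add_left_mono add_mono card_image_le) auto
  also have "\<dots> \<le> card \<S> + 2 * (2 ^ card \<S> * 2 ^ card \<S>)"
    using mult_mono[OF finC(2) finC(2)] by (simp add: card_cartesian_product)
  finally have c: "card \<S>' \<le> card \<S> + 2 * (2 ^ card \<S> * 2 ^ card \<S>)" .
  have sub: "\<S> \<subseteq> \<S>'" by (auto simp: \<S>'_def)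
  let ?D = "\<lambda>p. (cell_density R V \<S>' p - cell_density R V \<S> p)\<^sup>2"
  let ?I = "irregular_pairs R V \<S> \<epsilon>"
  let ?l = "map_prod (cell V \<S>) (cell V \<S>)"
  have finI: "finite ?I" using fin by (auto simp: irregular_pairs_def intro: finite_subset[of _ "V \<times> V"])
  have eq: "energy R V \<S>' = energy R V \<S> + sum ?D (V \<times> V)"
    unfolding energy_def cell_density_def
  proof (rule cell_avg_pythagoras)
    have "label \<S> x = label \<S>' x \<inter> \<S>" for x using sub by (auto simp: label_def)
    then show "map_prod (label \<S>) (label \<S>) p = map_prod (label \<S>) (label \<S>) q"
      if "map_prod (label \<S>') (label \<S>') p = map_prod (label \<S>') (label \<S>') q" for p q
      using that by (cases p; cases q) simp
  qed (use fin in auto)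
  \<comment> \<open>The sum is split over products of two cells. On each of them irregularity is
    constant: either the gain from the witness applies, or the indicator vanishes.\<close>
  have "0 \<le> (\<Sum>p\<in>V \<times> V. ?D p - \<epsilon> ^ 4 * indicator ?I p)"
  proof (subst sum.image_gen[where g = ?l], use fin in simp, rule sum_nonneg)
    fix AB assume "AB \<in> ?l ` (V \<times> V)"
    then obtain a b where ab: "a \<in> V" "b \<in> V" "AB = (cell V \<S> a, cell V \<S> b)" by auto
    define A B where "A = cell V \<S> a" and "B = cell V \<S> b"
    have cc: "cell V \<S> x = cell V \<S> y \<longleftrightarrow> x \<in> cell V \<S> y" if "x \<in> V" "y \<in> V" for x y
      using that by (auto simp: cell_def)
    have cs: "cell V \<S> y \<subseteq> V" for y by (auto simp: cell_def)
    have fib: "{p. p \<in> V \<times> V \<and> ?l p = AB} = A \<times> B"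
    proof (intro set_eqI)
      fix p
      have "x \<in> V \<and> cell V \<S> x = cell V \<S> a \<longleftrightarrow> x \<in> A"
        "x \<in> V \<and> cell V \<S> x = cell V \<S> b \<longleftrightarrow> x \<in> B" for x
        unfolding A_def B_def using ab cs cc by blast+
      moreover have "?l p = AB \<longleftrightarrow> cell V \<S> (fst p) = cell V \<S> a \<and> cell V \<S> (snd p) = cell V \<S> b"
        unfolding ab by (cases p) simp
      ultimately show "p \<in> {p. p \<in> V \<times> V \<and> ?l p = AB} \<longleftrightarrow> p \<in> A \<times> B"
        unfolding mem_Times_iff mem_Collect_eq by blast
    qed
    have finAB: "finite (A \<times> B)" using cs fin finite_subset unfolding A_def B_def by blast
    have "\<epsilon> ^ 4 * (\<Sum>p\<in>A \<times> B. indicator ?I p) \<le> sum ?D (A \<times> B)"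
    proof (cases "irregular R \<epsilon> A B")
      case True
      have "WX A B \<in> \<S>'" "WY A B \<in> \<S>'" using ab by (auto simp: \<S>'_def C_def A_def B_def)
      from sum_sq_ge_irregular[OF fin \<epsilon> W[OF True] this A_def B_def]
      have "\<epsilon> ^ 4 * (card A * card B) \<le> sum ?D (A \<times> B)" .
      moreover have "(\<Sum>p\<in>A \<times> B. indicator ?I p) \<le> (\<Sum>p\<in>A \<times> B. 1::real)"
        by (intro sum_mono) (auto simp: indicator_def)
      then have "\<epsilon> ^ 4 * (\<Sum>p\<in>A \<times> B. indicator ?I p) \<le> \<epsilon> ^ 4 * (card A * card B)"
        using \<epsilon> by (intro mult_left_mono) (auto simp: card_cartesian_product)
      ultimately show ?thesis by linarith
    next
      case False
      have "indicator ?I p = (0::real)" if pAB: "p \<in> A \<times> B" for p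
      proof -
        obtain x y where p: "p = (x, y)" "x \<in> A" "y \<in> B" using pAB by auto
        then have "cell V \<S> x = A" "cell V \<S> y = B" by (auto simp: A_def B_def cell_def)
        then show ?thesis using False p by (auto simp: irregular_pairs_def)
      qed
      then have "(\<Sum>p\<in>A \<times> B. indicator ?I p) = (0::real)" by simp
      then show ?thesis by (simp add: sum_nonneg)
    qed
    then show "0 \<le> (\<Sum>p\<in>{p. p \<in> V \<times> V \<and> ?l p = AB}. ?D p - \<epsilon> ^ 4 * indicator ?I p)"
      unfolding fib by (simp add: sum_subtractf sum_distrib_left)
  qed
  moreover have "(\<Sum>p\<in>V \<times> V. indicator ?I p) = (card ?I :: real)"
    using fin by (subst sum_indicator_real)
      (auto simp: irregular_pairs_def intro!: arg_cong[where f = card])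
  ultimately have "\<epsilon> ^ 4 * card ?I \<le> sum ?D (V \<times> V)"
    by (simp add: sum_subtractf flip: sum_distrib_left)
  then show ?thesis using c eq finC finS by (intro exI[of _ \<S>']) (auto simp: \<S>'_def)
qed

text \<open>Starting from the trivial partition, every failure of the bound raises the energy by at
  least \<open>\<epsilon>^5 * n^2\<close>. The number of rounds, and hence the size of the family,
  is bounded in terms of \<open>\<epsilon>\<close> alone.\<close>

theorem regularity:
  assumes \<epsilon>: "0 < (\<epsilon>::real)"
  shows "\<exists>M. \<forall>(V :: 'a set) R. finite V \<longrightarrow> (\<exists>\<S>. finite \<S> \<and> card \<S> \<le> M \<and>
    card (irregular_pairs R V \<S> \<epsilon>) \<le> \<epsilon> * (real (card V))\<^sup>2)"
proof -
  define g :: "nat \<Rightarrow> nat" where "g s = s + 2 * (2 ^ s * 2 ^ s)" for s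
  have g_mono: "g s \<le> g t" if "s \<le> t" for s t
    unfolding g_def using that by (intro add_mono mult_mono power_increasing) auto
  \<comment> \<open>With this \<open>k\<close>, \<open>k\<close> increments would exceed the maximal
    energy \<open>n^2\<close>.\<close>
  obtain k :: nat where k: "1 < k * \<epsilon> ^ 5" using \<epsilon> reals_Archimedean3[of "\<epsilon> ^ 5"] by auto
  show ?thesis
  proof (rule exI[of _ "(g ^^ k) 0"], intro allI impI)
    fix V :: "'a set" and R assume fin: "finite V"
    let ?n2 = "(real (card V))\<^sup>2"
    let ?reg = "\<lambda>\<S>. card (irregular_pairs R V \<S> \<epsilon>) \<le> \<epsilon> * ?n2"
    have "\<exists>\<S>. finite \<S> \<and> card \<S> \<le> (g ^^ j) 0 \<and> (?reg \<S> \<or> j * \<epsilon> ^ 5 * ?n2 \<le> energy R V \<S>)" for j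
    proof (induction j)
      case 0
      show ?case by (intro exI[of _ "{}"]) (simp add: energy_nonneg)
    next
      case (Suc j)
      then obtain \<S> where S: "finite \<S>" "card \<S> \<le> (g ^^ j) 0"
        "?reg \<S> \<or> j * \<epsilon> ^ 5 * ?n2 \<le> energy R V \<S>" by blast
      show ?case
      proof (cases "?reg \<S>")
        case True
        have "card \<S> \<le> (g ^^ Suc j) 0" using S(2) by (simp add: g_def)
        then show ?thesis using True S by blast
      next
        case False
        obtain \<S>' where S': "finite \<S>'" "card \<S>' \<le> g (card \<S>)"
          "energy R V \<S> + \<epsilon> ^ 4 * card (irregular_pairs R V \<S> \<epsilon>) \<le> energy R V \<S>'"
          using energy_increment[OF fin \<epsilon> S(1), of R] unfolding g_def by blast
        have "\<epsilon> ^ 4 * (\<epsilon> * ?n2) \<le> \<epsilon> ^ 4 * card (irregular_pairs R V \<S> \<epsilon>)"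
          using False \<epsilon> by (intro mult_left_mono) auto
        moreover have "\<epsilon> ^ 4 * (\<epsilon> * ?n2) = \<epsilon> ^ 5 * ?n2" by (simp add: numeral_eq_Suc)
        ultimately have "Suc j * \<epsilon> ^ 5 * ?n2 \<le> energy R V \<S>'"
          using S'(3) S(3) False by (simp add: distrib_right)
        moreover have "card \<S>' \<le> (g ^^ Suc j) 0" using S'(2) g_mono[OF S(2)] by simp
        ultimately show ?thesis using S'(1) by blast
      qed
    qed
    from this[of k] obtain \<S> where S: "finite \<S>" "card \<S> \<le> (g ^^ k) 0"
      "?reg \<S> \<or> k * \<epsilon> ^ 5 * ?n2 \<le> energy R V \<S>" by blast
    have "?reg \<S>"
    proof (rule ccontr)
      assume nr: "\<not> ?reg \<S>"
      then have "k * \<epsilon> ^ 5 * ?n2 \<le> ?n2" using S(3) energy_le[of R V \<S>] by linarith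
      then have "(k * \<epsilon> ^ 5 - 1) * ?n2 \<le> 0" by (simp add: algebra_simps)
      \<comment> \<open>The energy contradiction needs \<open>n > 0\<close>; for empty
        \<open>V\<close> there are no irregular pairs at all.\<close>
      then have "?n2 \<le> 0" using k by (simp add: mult_le_0_iff del: power2_less_eq_zero_iff)
      then have "card V = 0" by simp
      then have "V = {}" using fin by simp
      then show False using nr by (simp add: irregular_pairs_def)
    qed
    then show "\<exists>\<S>. finite \<S> \<and> card \<S> \<le> (g ^^ k) 0 \<and> ?reg \<S>" using S by blast
  qed
qed

subsection \<open>Triangle removal lemma\<close>

lemma regular_density:
  assumes "\<not> irregular R \<epsilon> A B" "X \<subseteq> A" "Y \<subseteq> B"
    "\<epsilon> * real (card A) \<le> card X" "\<epsilon> * real (card B) \<le> card Y"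
  shows "(density R A B - \<epsilon>) * real (card X * card Y) \<le> card (R \<inter> X \<times> Y)"
proof -
  have "\<not> irregular_witness R \<epsilon> A B X Y" using assms(1) by (auto simp: irregular_def)
  then have "\<bar>card (R \<inter> X \<times> Y) - density R A B * real (card X * card Y)\<bar> \<le> \<epsilon> * real (card X * card Y)"
    using assms unfolding irregular_witness_def by linarith
  then show ?thesis by (simp add: left_diff_distrib)
qed

text \<open>Otherwise the vertices of low degree are numerous enough for regularity against all of
  \<open>B\<close>. They then send at least the proportion \<open>\<epsilon>\<close> of possible
  edges to \<open>B\<close>, which their degrees do not permit.\<close>

lemma few_low_degree:
  fixes \<epsilon> :: real
  assumes fin: "finite A" "finite B" and \<epsilon>: "0 < \<epsilon>" "\<epsilon> \<le> 1"
    and reg: "\<not> irregular R \<epsilon> A B" and d: "2 * \<epsilon> \<le> density R A B" and B: "B \<noteq> {}" "A \<noteq> {}"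
  shows "card {a \<in> A. card (R `` {a} \<inter> B) < \<epsilon> * card B} < \<epsilon> * card A"
proof (rule ccontr)
  define X where "X = {a \<in> A. card (R `` {a} \<inter> B) < \<epsilon> * card B}"
  assume "\<not> ?thesis"
  then have X: "\<epsilon> * card A \<le> card X" by (simp add: X_def)
  have XA: "X \<subseteq> A" "finite X" using fin by (auto simp: X_def)
  have cB: "0 < card B" "0 < card A" using fin B by (simp_all add: card_gt_0_iff)
  then have "0 < \<epsilon> * real (card A)" using \<epsilon> by simp
  then have "0 < real (card X)" using X by linarith
  then have cX: "0 < card X" "X \<noteq> {}" by auto
  have eB: "\<epsilon> * real (card B) \<le> card B" using \<epsilon> by (simp add: mult_left_le_one_le)
  have "\<epsilon> * real (card X * card B) \<le> (density R A B - \<epsilon>) * real (card X * card B)"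
    using d by (intro mult_right_mono) auto
  also have "\<dots> \<le> card (R \<inter> X \<times> B)"
    using regular_density[OF reg XA(1) subset_refl X eB] .
  also have "R \<inter> X \<times> B = (SIGMA a:X. R `` {a} \<inter> B)" by auto
  also have "real (card \<dots>) = (\<Sum>a\<in>X. real (card (R `` {a} \<inter> B)))"
    using XA fin by (subst card_SigmaI) auto
  also have "\<dots> < (\<Sum>a\<in>X. \<epsilon> * card B)"
    using cX XA by (intro sum_strict_mono) (auto simp: X_def)
  finally show False by simp
qed

text \<open>At least half of the vertices of \<open>A\<close> have neighbourhoods of proportion
  \<open>\<epsilon>\<close> in both \<open>B\<close> and \<open>C\<close>. Regularity between these
  two neighbourhoods gives a further factor \<open>\<epsilon>\<close> for the edges that close
  triangles.\<close>

lemma triangle_counting: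
  fixes \<epsilon> :: real
  assumes fin: "finite A" "finite B" "finite C" and \<epsilon>: "0 < \<epsilon>" "\<epsilon> \<le> 1/4"
    and ne: "A \<noteq> {}" "B \<noteq> {}" "C \<noteq> {}"
    and reg: "\<not> irregular R \<epsilon> A B" "\<not> irregular R \<epsilon> A C" "\<not> irregular R \<epsilon> B C"
    and d: "2 * \<epsilon> \<le> density R A B" "2 * \<epsilon> \<le> density R A C" "2 * \<epsilon> \<le> density R B C"
  shows "\<epsilon> ^ 3 / 2 * (real (card A) * card B * card C)
    \<le> card {(a, b, c). a \<in> A \<and> b \<in> B \<and> c \<in> C \<and> (a, b) \<in> R \<and> (a, c) \<in> R \<and> (b, c) \<in> R}"
proof -
  define X where "X = {a \<in> A. card (R `` {a} \<inter> B) < \<epsilon> * card B}"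
  define Y where "Y = {a \<in> A. card (R `` {a} \<inter> C) < \<epsilon> * card C}"
  define Z where "Z = A - (X \<union> Y)"
  have e1: "\<epsilon> \<le> 1" using \<epsilon> by simp
  have "card X < \<epsilon> * card A" "card Y < \<epsilon> * card A"
    unfolding X_def Y_def using few_low_degree fin \<epsilon>(1) e1 reg d ne by blast+
  \<comment> \<open>The two exceptional sets together cover less than half of \<open>A\<close>; this
    is where the bound \<open>1/4\<close> enters.\<close>
  moreover have "\<epsilon> * card A \<le> 1/4 * card A" using \<epsilon> by (intro mult_right_mono) auto
  moreover have "card A \<le> card Z + (card X + card Y)"
  proof -
    have "A = Z \<union> (X \<union> Y)" by (auto simp: Z_def X_def Y_def)
    then show ?thesis by (metis card_Un_le le_trans add_left_mono)
  qed
  ultimately have Z: "card A / 2 \<le> card Z" by linarith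
  have finZ: "finite Z" using fin by (auto simp: Z_def)
  let ?T = "\<lambda>a. R \<inter> (R `` {a} \<inter> B) \<times> (R `` {a} \<inter> C)"
  have T: "\<epsilon> ^ 3 * (card B * card C) \<le> card (?T a)" if a: "a \<in> Z" for a
  proof -
    let ?b = "real (card (R `` {a} \<inter> B))" and ?c = "real (card (R `` {a} \<inter> C))"
    have b: "\<epsilon> * card B \<le> ?b" and c: "\<epsilon> * card C \<le> ?c"
      using a by (auto simp: Z_def X_def Y_def)
    have "\<epsilon> ^ 3 * (card B * card C) = \<epsilon> * ((\<epsilon> * card B) * (\<epsilon> * card C))"
      by (simp add: power3_eq_cube)
    also have "\<dots> \<le> \<epsilon> * (?b * ?c)" using b c \<epsilon> by (intro mult_left_mono mult_mono) auto
    also have "\<dots> \<le> (density R B C - \<epsilon>) * (?b * ?c)"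
      using d by (intro mult_right_mono) auto
    also have "\<dots> \<le> card (?T a)"
      using regular_density[OF reg(3) _ _ b c] by simp
    finally show ?thesis .
  qed
  have "\<epsilon> ^ 3 / 2 * (real (card A) * card B * card C) = (card A / 2) * (\<epsilon> ^ 3 * (card B * card C))"
    by simp
  also have "\<dots> \<le> card Z * (\<epsilon> ^ 3 * (card B * card C))"
    using Z \<epsilon> by (intro mult_right_mono) auto
  also have "\<dots> = (\<Sum>a\<in>Z. \<epsilon> ^ 3 * (card B * card C))" by simp
  also have "\<dots> \<le> (\<Sum>a\<in>Z. real (card (?T a)))" using T by (intro sum_mono) auto
  also have "\<dots> = card (SIGMA a:Z. ?T a)"
    using fin finZ by (subst card_SigmaI) auto
  also have "\<dots> \<le> card {(a, b, c). a \<in> A \<and> b \<in> B \<and> c \<in> C \<and> (a, b) \<in> R \<and> (a, c) \<in> R \<and> (b, c) \<in> R}"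
    using fin
    by (intro of_nat_mono card_mono, rule_tac finite_subset[of _ "A \<times> B \<times> C"])
      (auto simp: Z_def)
  finally show ?thesis .
qed

section \<open>Exceptional pairs and the removal argument\<close>

lemma card_small_cells:
  fixes t :: real
  assumes fin: "finite V" "finite \<S>" and t: "0 \<le> t"
  shows "card {x \<in> V. card (cell V \<S> x) < t} \<le> 2 ^ card \<S> * t"
proof -
  define C where "C = {A \<in> cell V \<S> ` V. card A < t}"
  have finC: "finite C" using card_cells_le(1)[OF fin(2)] by (simp add: C_def)
  have "card C \<le> card (cell V \<S> ` V)"
    unfolding C_def by (intro card_mono card_cells_le(1) fin) auto
  then have cC: "card C \<le> 2 ^ card \<S>" using card_cells_le(2)[OF fin(2), of V] by linarith
  have sub: "{x \<in> V. card (cell V \<S> x) < t} \<subseteq> \<Union>C" by (auto simp: C_def cell_def)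
  have finU: "finite (\<Union>C)"
    using finC fin by (auto simp: C_def cell_def)
  have "card {x \<in> V. card (cell V \<S> x) < t} \<le> card (\<Union>C)" using sub finU by (rule card_mono[rotated])
  also have "\<dots> \<le> (\<Sum>A\<in>C. card A)" using card_Union_le_sum_card by blast
  finally have "real (card {x \<in> V. card (cell V \<S> x) < t}) \<le> (\<Sum>A\<in>C. real (card A))"
    by (simp flip: of_nat_sum)
  also have "\<dots> \<le> (\<Sum>A\<in>C. t)" by (intro sum_mono) (auto simp: C_def)
  also have "\<dots> \<le> 2 ^ card \<S> * t" using cC t by (simp add: mult_right_mono numeral_power_le_of_nat_cancel_iff flip: of_nat_power)
  finally show ?thesis .
qed

text \<open>The condition on the density is constant on products of cells, so edges satisfying it
  may be counted by the average density, which is below \<open>d\<close> there.\<close>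

lemma card_sparse_pairs:
  fixes d :: real
  assumes "finite V" "0 \<le> d"
  shows "card {p \<in> R \<inter> V \<times> V. cell_density R V \<S> p < d} \<le> d * (real (card V))\<^sup>2"
proof -
  let ?w = "\<lambda>p. if cell_density R V \<S> p < d then 1 else (0::real)"
  have "real (card {p \<in> R \<inter> V \<times> V. cell_density R V \<S> p < d})
      = (\<Sum>p\<in>V \<times> V. indicator {p \<in> R \<inter> V \<times> V. cell_density R V \<S> p < d} p)"
    using assms by (subst sum_indicator_real) (auto intro!: arg_cong[where f = card])
  also have "\<dots> = (\<Sum>p\<in>V \<times> V. ?w p * indicator R p)"
    by (intro sum.cong refl) (auto simp: indicator_def)
  also have "\<dots> = (\<Sum>p\<in>V \<times> V. ?w p * cell_density R V \<S> p)"
    unfolding cell_density_def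
  proof (rule sum_mult_cell_avg[symmetric])
    fix p q assume "map_prod (label \<S>) (label \<S>) p = map_prod (label \<S>) (label \<S>) q"
    from cell_avg_cong[where l = "map_prod (label \<S>) (label \<S>)", OF this]
    show "(if cell_avg (V \<times> V) (map_prod (label \<S>) (label \<S>)) (indicator R) p < d then 1 else 0)
      = (if cell_avg (V \<times> V) (map_prod (label \<S>) (label \<S>)) (indicator R) q < d then 1 else 0)"
      by simp
  qed (use assms in simp)
  also have "\<dots> \<le> (\<Sum>p\<in>V \<times> V. d)"
    using assms by (intro sum_mono) (simp add: less_imp_le)
  also have "\<dots> = d * (real (card V))\<^sup>2" by (simp add: card_cartesian_product power2_eq_square)
  finally show ?thesis .
qed

text \<open>This is the form of the lemma for edge-disjoint triangles. The bad pairs are too few to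
  hit all of them, and the three cells of a triangle without bad pairs satisfy the hypotheses of
  \<open>triangle_counting\<close>.\<close>

theorem triangle_removal:
  assumes \<epsilon>: "0 < (\<epsilon>::real)"
  shows "\<exists>\<delta>>0. \<forall>(V :: 'a set) R T. finite V \<longrightarrow>
    (\<forall>(x, y, z)\<in>T. {x, y, z} \<subseteq> V \<and> (x, y) \<in> R \<and> (x, z) \<in> R \<and> (y, z) \<in> R) \<longrightarrow>
    (\<forall>(x, y, z)\<in>T. \<forall>(x', y', z')\<in>T. (x, y, z) \<noteq> (x', y', z') \<longrightarrow>
       {(x, y), (x, z), (y, z)} \<inter> {(x', y'), (x', z'), (y', z')} = {}) \<longrightarrow>
    \<epsilon> * (real (card V))\<^sup>2 < card T \<longrightarrow>
    \<delta> * real (card V) ^ 3 \<le> card {(x, y, z) \<in> V \<times> V \<times> V. (x, y) \<in> R \<and> (x, z) \<in> R \<and> (y, z) \<in> R}"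
proof -
  \<comment> \<open>The bad pairs cost \<open>5 * e\<close>: \<open>e\<close> for irregular pairs,
    \<open>2 * e\<close> for sparse edges, and \<open>e\<close> for each coordinate that may lie in
    a small cell. The bound \<open>1/4\<close> serves \<open>triangle_counting\<close>.\<close>
  define e where "e = min (1/4) (\<epsilon> / 5)"
  have e: "0 < e" "e \<le> 1/4" "5 * e \<le> \<epsilon>" using \<epsilon> by (auto simp: e_def min_def)
  obtain M where M: "\<And>(V :: 'a set) R. finite V \<Longrightarrow> \<exists>\<S>. finite \<S> \<and> card \<S> \<le> M \<and>
    card (irregular_pairs R V \<S> e) \<le> e * (real (card V))\<^sup>2"
    using regularity[OF e(1), where 'a = 'a] by blast
  \<comment> \<open>At most \<open>2 ^ M\<close> cells are smaller than \<open>\<eta> * n\<close>,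
    so together they contain at most \<open>e * n\<close> points.\<close>
  define \<eta> where "\<eta> = e / 2 ^ M"
  have \<eta>: "0 < \<eta>" using e by (simp add: \<eta>_def)
  show ?thesis
  proof (intro exI[of _ "e ^ 3 / 2 * \<eta> ^ 3"] conjI allI impI)
    show "0 < e ^ 3 / 2 * \<eta> ^ 3" using e \<eta> by simp
  next
    fix V :: "'a set" and R T
    assume fin: "finite V"
      and tri: "\<forall>(x, y, z)\<in>T. {x, y, z} \<subseteq> V \<and> (x, y) \<in> R \<and> (x, z) \<in> R \<and> (y, z) \<in> R"
      and disj: "\<forall>(x, y, z)\<in>T. \<forall>(x', y', z')\<in>T. (x, y, z) \<noteq> (x', y', z') \<longrightarrow>
        {(x, y), (x, z), (y, z)} \<inter> {(x', y'), (x', z'), (y', z')} = {}"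
      and large: "\<epsilon> * (real (card V))\<^sup>2 < card T"
    let ?n = "real (card V)"
    obtain \<S> where S: "finite \<S>" "card \<S> \<le> M" "card (irregular_pairs R V \<S> e) \<le> e * ?n\<^sup>2"
      using M[OF fin] by blast
    define L where "L = {x \<in> V. card (cell V \<S> x) < \<eta> * ?n}"
    define D where "D = irregular_pairs R V \<S> e \<union> {p \<in> R \<inter> V \<times> V. cell_density R V \<S> p < 2 * e}
      \<union> (L \<times> V \<union> V \<times> L)"
    have "card L \<le> 2 ^ card \<S> * (\<eta> * ?n)"
      unfolding L_def using card_small_cells[OF fin S(1)] \<eta> by simp
    also have "\<dots> \<le> 2 ^ M * (\<eta> * ?n)"
      using S \<eta> by (intro mult_right_mono power_increasing) auto
    also have "\<dots> = e * ?n" by (simp add: \<eta>_def)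
    finally have "card L * ?n \<le> e * ?n\<^sup>2"
      by (simp add: power2_eq_square mult_right_mono flip: mult.assoc)
    then have cL: "card (L \<times> V) \<le> e * ?n\<^sup>2" "card (V \<times> L) \<le> e * ?n\<^sup>2"
      by (simp_all add: card_cartesian_product mult.commute)
    have "card D \<le> (card (irregular_pairs R V \<S> e) + card {p \<in> R \<inter> V \<times> V. cell_density R V \<S> p < 2 * e})
        + (card (L \<times> V) + card (V \<times> L))"
      unfolding D_def by (meson card_Un_le le_trans add_mono)
    then have "real (card D) \<le> (card (irregular_pairs R V \<S> e) + card {p \<in> R \<inter> V \<times> V. cell_density R V \<S> p < 2 * e})
        + (card (L \<times> V) + card (V \<times> L))" by linarith
    also have "\<dots> \<le> (e * ?n\<^sup>2 + 2 * e * ?n\<^sup>2) + (e * ?n\<^sup>2 + e * ?n\<^sup>2)"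
      using S(3) cL card_sparse_pairs[OF fin, of "2 * e" R \<S>] e by simp
    also have "\<dots> = 5 * e * ?n\<^sup>2" by simp
    also have "\<dots> \<le> \<epsilon> * ?n\<^sup>2" using e by (intro mult_right_mono) auto
    finally have cD: "card D \<le> \<epsilon> * ?n\<^sup>2" .
    have finD: "finite D"
      by (rule finite_subset[of _ "V \<times> V"]) (use fin in \<open>auto simp: D_def L_def irregular_pairs_def\<close>)
    define P where "P = (\<lambda>(x :: 'a, y :: 'a, z :: 'a). {(x, y), (x, z), (y, z)})"
    have disj': "P s \<inter> P t = {}" if "s \<in> T" "t \<in> T" "s \<noteq> t" for s t
      using disj that unfolding P_def by fast
    \<comment> \<open>If every triangle contained a bad pair, choosing one in each would be
      injective by edge-disjointness, and \<open>D\<close> would be too large.\<close>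
    have "\<exists>t\<in>T. P t \<inter> D = {}"
    proof (rule ccontr)
      assume "\<not> ?thesis"
      then have "\<forall>t\<in>T. \<exists>p. p \<in> P t \<inter> D" by auto
      then obtain f where f: "\<forall>t\<in>T. f t \<in> P t \<inter> D"
        by (rule bchoice[THEN exE])
      have "inj_on f T"
        using f disj' by (intro inj_onI) (metis IntD1 disjoint_iff)
      then have "card T \<le> card D" using f finD by (intro card_inj_on_le[of f]) auto
      then show False using cD large by linarith
    qed
    then obtain x y z where xyz: "(x, y, z) \<in> T"
      and nD: "(x, y) \<notin> D" "(x, z) \<notin> D" "(y, z) \<notin> D"
      by (auto simp: P_def)
    have V: "x \<in> V" "y \<in> V" "z \<in> V" and RR: "(x, y) \<in> R" "(x, z) \<in> R" "(y, z) \<in> R"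
      using tri xyz by auto
    let ?c = "cell V \<S>"
    have fc: "finite (?c v)" for v using fin by (auto simp: cell_def)
    have nec: "?c v \<noteq> {}" if "v \<in> V" for v using that by (auto simp: cell_def)
    have big: "\<eta> * ?n \<le> card (?c x)" "\<eta> * ?n \<le> card (?c y)" "\<eta> * ?n \<le> card (?c z)"
      using nD V by (auto simp: D_def L_def)
    have reg: "\<not> irregular R e (?c x) (?c y)" "\<not> irregular R e (?c x) (?c z)" "\<not> irregular R e (?c y) (?c z)"
      using nD V by (auto simp: D_def irregular_pairs_def)
    have dens: "2 * e \<le> density R (?c x) (?c y)" "2 * e \<le> density R (?c x) (?c z)" "2 * e \<le> density R (?c y) (?c z)"
      using nD V RR by (auto simp: D_def cell_density_eq[OF fin])
    have "\<eta> ^ 3 * ?n ^ 3 = (\<eta> * ?n) * (\<eta> * ?n) * (\<eta> * ?n)" by (simp add: power3_eq_cube)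
    also have "\<dots> \<le> real (card (?c x)) * card (?c y) * card (?c z)"
      using big \<eta> by (intro mult_mono) auto
    finally have "e ^ 3 / 2 * (\<eta> ^ 3 * ?n ^ 3) \<le> e ^ 3 / 2 * (real (card (?c x)) * card (?c y) * card (?c z))"
      using e by (intro mult_left_mono) auto
    also have "\<dots> \<le> card {(a, b, c). a \<in> ?c x \<and> b \<in> ?c y \<and> c \<in> ?c z \<and> (a, b) \<in> R \<and> (a, c) \<in> R \<and> (b, c) \<in> R}"
      using triangle_counting[OF fc fc fc e(1,2) nec nec nec reg dens] V by blast
    also have "\<dots> \<le> card {(x, y, z) \<in> V \<times> V \<times> V. (x, y) \<in> R \<and> (x, z) \<in> R \<and> (y, z) \<in> R}"
      using fin
      by (intro of_nat_mono card_mono, rule_tac finite_subset[of _ "V \<times> V \<times> V"]) (auto simp: cell_def)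
    finally show "e ^ 3 / 2 * \<eta> ^ 3 * ?n ^ 3
        \<le> card {(x, y, z) \<in> V \<times> V \<times> V. (x, y) \<in> R \<and> (x, z) \<in> R \<and> (y, z) \<in> R}"
      by (simp add: mult.assoc)
  qed
qed

subsection \<open>Finite combinatorics of pairs and triangles\<close>

lemma card_le_fibers:
  assumes "finite B" "f ` A \<subseteq> B" "\<And>b. b \<in> B \<Longrightarrow> card {a \<in> A. f a = b} \<le> k"
  shows "card A \<le> card B * k"
proof -
  have "A = (\<Union>b\<in>B. {a \<in> A. f a = b})" using assms(2) by auto
  then have "card A \<le> (\<Sum>b\<in>B. card {a \<in> A. f a = b})"
    using card_UN_le[OF assms(1), of "\<lambda>b. {a \<in> A. f a = b}"] by simp
  also have "\<dots> \<le> (\<Sum>b\<in>B. k)" using assms(3) by (rule sum_mono)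
  finally show ?thesis by simp
qed

text \<open>Elements are added one at a time unless they conflict with one already kept. With
  \<open>c\<close> meaning that two triangles share a pair, this extracts edge-disjoint
  triangles.\<close>

lemma maximal_independent_subset:
  assumes "finite A" and sym: "\<And>x y. c x y \<Longrightarrow> c y x"
  shows "\<exists>I\<subseteq>A. (\<forall>x\<in>I. \<forall>y\<in>I. x \<noteq> y \<longrightarrow> \<not> c x y) \<and> (\<forall>x\<in>A. \<exists>y\<in>I. x = y \<or> c x y)"
  using assms(1)
proof (induction A)
  case empty
  then show ?case by simp
next
  case (insert a A)
  then obtain I where I: "I \<subseteq> A" "\<forall>x\<in>I. \<forall>y\<in>I. x \<noteq> y \<longrightarrow> \<not> c x y"
    "\<forall>x\<in>A. \<exists>y\<in>I. x = y \<or> c x y" by blast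
  show ?case
  proof (cases "\<exists>y\<in>I. c a y")
    case True
    then show ?thesis using I by (intro exI[of _ I]) blast
  next
    case False
    then show ?thesis using I sym by (intro exI[of _ "insert a I"]) blast
  qed
qed

text \<open>Choosing for one element enlarges \<open>U\<close> by one and shrinks \<open>A\<close>
  by one, so the size condition survives. The forbidden set \<open>U\<close> will hold the
  hyperedges already assigned.\<close>

lemma greedy_representatives:
  assumes "finite A" "finite U" "\<And>e. e \<in> A \<Longrightarrow> card U + card A \<le> card (S e)"
  shows "\<exists>f. inj_on f A \<and> (\<forall>e\<in>A. f e \<in> S e - U)"
  using assms
proof (induction A arbitrary: U)
  case empty
  then show ?case by simp
next
  case (insert a A)
  have "\<not> S a \<subseteq> U"
  proof
    assume "S a \<subseteq> U"
    then have "card (S a) \<le> card U" using insert.prems(1) by (intro card_mono)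
    moreover have "card U + card (insert a A) \<le> card (S a)" using insert.prems(2) by simp
    ultimately show False using insert.hyps by simp
  qed
  then obtain s where s: "s \<in> S a" "s \<notin> U" by blast
  have "card (insert s U) + card A \<le> card (S e)" if "e \<in> A" for e
    using insert.prems(2)[of e] that insert.hyps insert.prems(1) s by simp
  then obtain f where f: "inj_on f A" "\<forall>e\<in>A. f e \<in> S e - insert s U"
    using insert.IH[of "insert s U"] insert.prems(1) by blast
  have "inj_on (f(a := s)) (insert a A)"
    using f insert.hyps by (auto simp: inj_on_def)
  moreover have "\<forall>e\<in>insert a A. (f(a := s)) e \<in> S e - U" using f s by auto
  ultimately show ?case by blast
qed

section \<open>Pairs, triples and triangle counts\<close>

definition pairs :: "'a set \<Rightarrow> 'a set set" where
  "pairs T = {p. p \<subseteq> T \<and> card p = 2}"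

lemma finite_pairs: "finite T \<Longrightarrow> finite (pairs T)"
  by (simp add: pairs_def)

lemma card_pairs_triple: "card T = 3 \<Longrightarrow> card (pairs T) = 3"
  using n_subsets[of T 2] card.infinite[of T] unfolding pairs_def
  by (cases "finite T") (simp_all add: numeral_eq_Suc)

lemma pairs_mem: "x \<in> T \<Longrightarrow> y \<in> T \<Longrightarrow> x \<noteq> y \<Longrightarrow> {x, y} \<in> pairs T"
  by (simp add: pairs_def)

lemma pairsE:
  assumes "p \<in> pairs T" obtains x y where "x \<in> T" "y \<in> T" "x \<noteq> y" "p = {x, y}"
  using assms by (auto simp: pairs_def card_2_iff)

lemma pairs_iff: "(\<forall>x\<in>T. \<forall>y\<in>T. x \<noteq> y \<longrightarrow> {x, y} \<in> G) \<longleftrightarrow> pairs T \<subseteq> G"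
  by (auto intro: pairs_mem elim!: pairsE)

lemma card_pairs_le: "card (pairs {..<n::nat}) \<le> n\<^sup>2"
proof -
  have "pairs {..<n} \<subseteq> (\<lambda>(x, y). {x, y}) ` ({..<n} \<times> {..<n})"
    by (auto elim!: pairsE)
  then have "card (pairs {..<n}) \<le> card ({..<n} \<times> {..<n})"
    by (rule surj_card_le[rotated]) simp
  then show ?thesis by (simp add: card_cartesian_product power2_eq_square)
qed

text \<open>Two distinct pairs have at least three points in their union, which therefore is the
  whole of either triple.\<close>

lemma two_pairs_determine_triple:
  assumes "card T = 3" "card T' = 3" "T \<noteq> T'" shows "card (pairs T \<inter> pairs T') \<le> 1"
proof (rule ccontr)
  assume "\<not> ?thesis"
  moreover have f: "finite T" "finite T'" using assms by (metis card.infinite zero_neq_numeral)+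
  then have "finite (pairs T \<inter> pairs T')" by (simp add: finite_pairs)
  ultimately have "\<not> (\<forall>p\<in>pairs T \<inter> pairs T'. \<forall>q\<in>pairs T \<inter> pairs T'. p = q)"
    by (simp add: card_le_Suc0_iff_eq)
  then obtain p q where pq: "p \<in> pairs T \<inter> pairs T'" "q \<in> pairs T \<inter> pairs T'" "p \<noteq> q"
    by blast
  have p: "p \<union> q \<subseteq> T" "p \<union> q \<subseteq> T'" "card p = 2" "card q = 2" using pq by (auto simp: pairs_def)
  have fp: "finite p" "finite q" using p f finite_subset by auto
  have "card (p \<union> q) \<noteq> 2"
    using p fp pq(3) by (metis Un_upper1 Un_upper2 card_subset_eq finite_UnI)
  moreover have "card (p \<union> q) \<ge> 2" using p(3) fp by (metis Un_upper1 card_mono finite_UnI)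
  ultimately have "3 \<le> card (p \<union> q)" by simp
  then have "p \<union> q = T" "p \<union> q = T'" using p f assms by (metis card_seteq)+
  then show False using assms by simp
qed

definition triangle_set :: "nat \<Rightarrow> nat set set \<Rightarrow> nat set set" where
  "triangle_set n G = {T. T \<subseteq> {..<n} \<and> card T = 3 \<and> pairs T \<subseteq> G}"

lemma triangles_eq: "triangles n G = card (triangle_set n G)"
  by (simp add: triangles_def triangle_set_def pairs_iff)

lemma finite_triangle_set: "finite (triangle_set n G)"
  by (rule finite_subset[of _ "Pow {..<n}"]) (auto simp: triangle_set_def)

text \<open>A supremum over \<open>nat\<close> dominates the members of a bounded set; here the
  number of subsets of \<open>{..<n}\<close> is a bound.\<close>

lemma triangles_le_ex_K3:
  assumes "host_graph n G" "\<not> contains_copy V E n G"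
  shows "card (triangle_set n G) \<le> ex_K3 V E n"
  unfolding ex_K3_def
proof (rule cSup_upper)
  show "bdd_above {triangles n G |G. host_graph n G \<and> \<not> contains_copy V E n G}"
    unfolding triangles_eq
    by (intro bdd_aboveI[of _ "card (Pow {..<n})"])
      (auto intro!: card_mono simp: triangle_set_def simp del: card_Pow)
qed (use assms in \<open>auto simp: triangles_eq\<close>)

text \<open>A bounded nonempty set of naturals attains its supremum; for the empty set
  \<open>Sup\<close> is 0, hence the condition \<open>0 \<le> b\<close>.\<close>

lemma real_Sup_nat_le:
  assumes "\<And>x. x \<in> X \<Longrightarrow> real x \<le> b" "0 \<le> b" shows "real (Sup X) \<le> b"
proof (cases "X = {}")
  case False
  have "X \<subseteq> {..nat \<lfloor>b\<rfloor>}" using assms by (auto simp: le_nat_floor)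
  then have "finite X" using finite_subset by blast
  then show ?thesis using False assms by (simp add: Sup_nat_def)
qed (use assms in simp)

text \<open>Choose one element of each three-element block uniformly at random. A set
  \<open>Q T\<close> meets at most three blocks, each in one element, so it is chosen entirely with
  probability at least \<open>1/27\<close>. Some choice does at least as well as the
  average.\<close>

lemma exists_good_transversal:
  assumes fin: "finite S" "finite D"
    and B: "\<And>h. h \<in> S \<Longrightarrow> card (B h) = 3"
    and disj: "\<And>h h'. h \<in> S \<Longrightarrow> h' \<in> S \<Longrightarrow> h \<noteq> h' \<Longrightarrow> B h \<inter> B h' = {}"
    and Q: "\<And>T. T \<in> D \<Longrightarrow> card (Q T) = 3" "\<And>T. T \<in> D \<Longrightarrow> Q T \<subseteq> (\<Union>h\<in>S. B h)"
    and rainbow: "\<And>T h. T \<in> D \<Longrightarrow> h \<in> S \<Longrightarrow> card (Q T \<inter> B h) \<le> 1"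
  shows "\<exists>a \<in> Pi\<^sub>E S B. card D \<le> 27 * card {T \<in> D. Q T \<subseteq> a ` S}"
proof -
  let ?P = "Pi\<^sub>E S B"
  have finB: "finite (B h)" if "h \<in> S" for h using B[OF that] card.infinite by fastforce
  have finP: "finite ?P" using fin finB by (intro finite_PiE)
  have cP: "card ?P = 3 ^ card S" using fin B by (simp add: card_PiE)
  then have neP: "?P \<noteq> {}" by auto
  have count: "card ?P \<le> 27 * card {a \<in> ?P. Q T \<subseteq> a ` S}" if T: "T \<in> D" for T
  proof -
    define K where "K = {h \<in> S. Q T \<inter> B h \<noteq> {}}"
    have finQ: "finite (Q T)" using Q(1)[OF T] card.infinite by fastforce
    have K: "K \<subseteq> S" "finite K" using fin by (auto simp: K_def)
    obtain q where q: "\<forall>h\<in>K. q h \<in> Q T \<inter> B h"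
      using bchoice[of K "\<lambda>h e. e \<in> Q T \<inter> B h"] by (auto simp: K_def)
    have "inj_on q K" using q disj K by (intro inj_onI) (metis IntD2 disjoint_iff subsetD)
    then have cK: "card K \<le> 3" using q finQ Q(1)[OF T] card_inj_on_le[of q K "Q T"] by auto
    have single: "e = q h" if "h \<in> K" "e \<in> Q T \<inter> B h" for e h
    proof -
      have "finite (Q T \<inter> B h)" using finQ by simp
      moreover have "card (Q T \<inter> B h) \<le> Suc 0" using rainbow[OF T] that K by auto
      ultimately show ?thesis using that q by (metis card_le_Suc0_iff_eq)
    qed
    \<comment> \<open>Fixing the choice on the blocks in \<open>K\<close> puts all of
      \<open>Q T\<close> into the transversal, while the choices on the other blocks remain
      free.\<close>
    have "Pi\<^sub>E S (\<lambda>h. if h \<in> K then {q h} else B h) \<subseteq> {a \<in> ?P. Q T \<subseteq> a ` S}"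
    proof
      fix a assume a: "a \<in> Pi\<^sub>E S (\<lambda>h. if h \<in> K then {q h} else B h)"
      have "a \<in> ?P" using a q by (auto simp: PiE_iff split: if_splits)
      moreover have "e \<in> a ` S" if e: "e \<in> Q T" for e
      proof -
        obtain h where h: "h \<in> S" "e \<in> B h" using e Q(2)[OF T] by blast
        then have "h \<in> K" using e by (auto simp: K_def)
        then have "a h = e" using single[of h e] e h a by (auto simp: PiE_iff)
        then show ?thesis using h by blast
      qed
      ultimately show "a \<in> {a \<in> ?P. Q T \<subseteq> a ` S}" by blast
    qed
    then have "card (Pi\<^sub>E S (\<lambda>h. if h \<in> K then {q h} else B h)) \<le> card {a \<in> ?P. Q T \<subseteq> a ` S}"
      using finP by (intro card_mono) auto
    moreover have "card (Pi\<^sub>E S (\<lambda>h. if h \<in> K then {q h} else B h)) = (\<Prod>h\<in>S. if h \<in> K then 1 else 3)"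
      using fin B by (auto simp: card_PiE intro!: prod.cong)
    moreover have "\<dots> = 3 ^ card (S - K)"
      using fin by (simp add: prod.If_cases Diff_eq)
    moreover have "(3::nat) ^ card S \<le> 27 * 3 ^ card (S - K)"
    proof -
      have "card S = card K + card (S - K)"
        using K fin by (metis card_Diff_subset card_mono le_add_diff_inverse)
      then have "(3::nat) ^ card S = 3 ^ card K * 3 ^ card (S - K)" by (simp add: power_add)
      also have "\<dots> \<le> 3 ^ 3 * 3 ^ card (S - K)" using cK by (intro mult_right_mono power_increasing) auto
      finally show ?thesis by simp
    qed
    ultimately show ?thesis using cP by linarith
  qed
  show ?thesis
  proof (rule ccontr)
    assume "\<not> ?thesis"
    then have less: "27 * card {T \<in> D. Q T \<subseteq> a ` S} < card D" if "a \<in> ?P" for a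
      using that by fastforce
    \<comment> \<open>Double counting of the incidences between sets \<open>T\<close> and
      transversals \<open>a\<close>.\<close>
    have "card D * card ?P = (\<Sum>T\<in>D. card ?P)" by simp
    also have "\<dots> \<le> (\<Sum>T\<in>D. 27 * card {a \<in> ?P. Q T \<subseteq> a ` S})" by (intro sum_mono count)
    also have "\<dots> = 27 * (\<Sum>T\<in>D. card {a \<in> ?P. Q T \<subseteq> a ` S})" by (simp add: sum_distrib_left)
    also have "(\<Sum>T\<in>D. card {a \<in> ?P. Q T \<subseteq> a ` S}) = (\<Sum>a\<in>?P. card {T \<in> D. Q T \<subseteq> a ` S})"
      using sum_multicount_gen[OF fin(2) finP, of "\<lambda>T a. Q T \<subseteq> a ` S" "\<lambda>a. card {T \<in> D. Q T \<subseteq> a ` S}"]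
      by simp
    also have "27 * \<dots> = (\<Sum>a\<in>?P. 27 * card {T \<in> D. Q T \<subseteq> a ` S})" by (simp add: sum_distrib_left)
    also have "\<dots> < (\<Sum>a\<in>?P. card D)" using less finP neP by (intro sum_strict_mono) auto
    finally show False by (simp add: mult.commute)
  qed
qed

subsection \<open>Dense graphs contain bipartite graphs\<close>

lemma complete_bipartite_contains_copy:
  fixes c :: "'a \<Rightarrow> nat"
  assumes F: "graph_on V E" and c: "\<And>v. v \<in> V \<Longrightarrow> c v < 2"
    and col: "\<And>e u v. e \<in> E \<Longrightarrow> u \<in> e \<Longrightarrow> v \<in> e \<Longrightarrow> u \<noteq> v \<Longrightarrow> c u \<noteq> c v"
    and S: "S \<subseteq> {..<n}" "card V \<le> card S" and W: "W \<subseteq> {..<n}" "card V \<le> card W"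
    and G: "host_graph n G" "\<And>x y. x \<in> S \<Longrightarrow> y \<in> W \<Longrightarrow> {x, y} \<in> G"
  shows "contains_copy V E n G"
proof -
  have finV: "finite V" using F by (simp add: graph_on_def)
  have fin: "finite S" "finite W" using S W finite_subset by auto
  obtain f where f: "inj_on f V" "f ` V \<subseteq> S" using inj_on_iff_card_le[OF finV fin(1)] S by auto
  obtain g where g: "inj_on g V" "g ` V \<subseteq> W" using inj_on_iff_card_le[OF finV fin(2)] W by auto
  have disj: "x \<noteq> y" if "x \<in> S" "y \<in> W" for x y
    using G that by (force simp: host_graph_def)
  define \<phi> where "\<phi> v = (if c v = 0 then f v else g v)" for v
  have "inj_on \<phi> V"
    using f g disj by (auto simp: inj_on_def \<phi>_def image_subset_iff) (metis disj)+
  moreover have "\<phi> ` V \<subseteq> {..<n}" using f g S W by (auto simp: \<phi>_def)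
  moreover have "\<phi> ` e \<in> G" if e: "e \<in> E" for e
  proof -
    have "card e = 2" "e \<subseteq> V" using F e by (auto simp: graph_on_def)
    then obtain u v where uv: "e = {u, v}" "u \<noteq> v" "u \<in> V" "v \<in> V" by (auto simp: card_2_iff)
    then have "c u \<noteq> c v" "c u < 2" "c v < 2" using col[OF e] c by auto
    then consider "c u = 0" "c v \<noteq> 0" | "c u \<noteq> 0" "c v = 0" by linarith
    then show ?thesis
    proof cases
      case 1
      then have "\<phi> ` e = {f u, g v}" using uv by (auto simp: \<phi>_def)
      then show ?thesis using G(2)[of "f u" "g v"] f g uv by auto
    next
      case 2
      then have "\<phi> ` e = {f v, g u}" using uv by (auto simp: \<phi>_def)
      then show ?thesis using G(2)[of "f v" "g u"] f g uv by auto
    qed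
  qed
  ultimately show ?thesis unfolding contains_copy_def by blast
qed

text \<open>A qualitative Kovari-Sos-Turan theorem. Fix \<open>m\<close> vertices of large degree.
  Many vertices have at least \<open>t\<close> neighbours among them, and by pigeonhole more than
  \<open>t\<close> of these have the same neighbours there, which yields a complete bipartite graph
  with both sides at least \<open>t\<close>.\<close>

lemma dense_graph_contains_bipartite:
  fixes c :: "'a \<Rightarrow> nat" and \<epsilon> :: real
  assumes F: "graph_on V E" and c: "\<And>v. v \<in> V \<Longrightarrow> c v < 2"
    and col: "\<And>e u v. e \<in> E \<Longrightarrow> u \<in> e \<Longrightarrow> v \<in> e \<Longrightarrow> u \<noteq> v \<Longrightarrow> c u \<noteq> c v"
    and \<epsilon>: "0 < \<epsilon>"
  shows "\<exists>N. \<forall>n\<ge>N. \<forall>G. host_graph n G \<longrightarrow> \<epsilon> * (real n)\<^sup>2 < card G \<longrightarrow> contains_copy V E n G"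
proof -
  define t where "t = card V"
  \<comment> \<open>There are at least \<open>m * \<epsilon> / 2 * n\<close> incidences with the
    fixed vertices. Vertices with fewer than \<open>t\<close> of them account for at most
    \<open>t * n\<close>, which this choice makes at most half.\<close>
  obtain m :: nat where m: "4 * real t + 1 \<le> m * \<epsilon>"
    using \<epsilon> reals_Archimedean3[of \<epsilon>] by (meson less_imp_le)
  have m0: "0 < m" using m \<epsilon> by (cases m) auto
  \<comment> \<open>The summand \<open>m\<close> ensures enough vertices of large degree, and
    \<open>2 ^ m * t\<close> is the number that the pigeonhole over subsets of \<open>M\<close> has
    to exceed.\<close>
  define b where "b = m + 2 ^ m * t"
  have b: "m \<le> b" "2 ^ m * t \<le> b" by (simp_all add: b_def)
  obtain N :: nat where N: "4 * real b + 1 \<le> N * \<epsilon>"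
    using \<epsilon> reals_Archimedean3[of \<epsilon>] by (meson less_imp_le)
  show ?thesis
  proof (intro exI[of _ N] allI impI)
    fix n G assume n: "N \<le> n" and host: "host_graph n G" and dense: "\<epsilon> * (real n)\<^sup>2 < card G"
    have "N * \<epsilon> \<le> n * \<epsilon>" using n \<epsilon> by (intro mult_right_mono) auto
    then have n': "4 * real b + 1 \<le> n * \<epsilon>" using N by linarith
    then have "0 < n * \<epsilon>" by linarith
    then have n0: "0 < real n" using \<epsilon> by (simp add: zero_less_mult_iff)
    let ?N = "\<lambda>x. {y \<in> {..<n}. {x, y} \<in> G}"
    define X where "X = {x \<in> {..<n}. \<epsilon> / 2 * n \<le> card (?N x)}"
    have cN: "card (?N x) \<le> n" for x
      by (rule order_trans[OF card_mono[of "{..<n}"]]) auto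
    have "G \<subseteq> (\<lambda>(x, y). {x, y}) ` (SIGMA x:{..<n}. ?N x)"
    proof
      fix p assume p: "p \<in> G"
      then have "card p = 2" "p \<subseteq> {..<n}" using host by (auto simp: host_graph_def)
      then obtain x y where "p = {x, y}" "x < n" "y < n" by (auto simp: card_2_iff)
      then show "p \<in> (\<lambda>(x, y). {x, y}) ` (SIGMA x:{..<n}. ?N x)" using p by force
    qed
    then have "card G \<le> card (SIGMA x:{..<n}. ?N x)"
      by (rule surj_card_le[rotated]) (intro finite_SigmaI, auto)
    also have "\<dots> = (\<Sum>x<n. card (?N x))" by (intro card_SigmaI) auto
    finally have "real (card G) \<le> (\<Sum>x<n. real (card (?N x)))" by (simp flip: of_nat_sum)
    \<comment> \<open>Vertices of small degree account for at most half of
      \<open>\<epsilon> * n^2\<close>, so the others must account for the rest.\<close>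
    also have "\<dots> \<le> (\<Sum>x<n. (if x \<in> X then real n else 0) + \<epsilon> / 2 * n)"
      using cN \<epsilon> by (intro sum_mono) (auto simp: X_def add_increasing2)
    also have "\<dots> = card X * n + \<epsilon> / 2 * n * n"
      by (simp add: sum.distrib X_def flip: sum.inter_filter)
    finally have "\<epsilon> / 2 * n * n < card X * real n" using dense by (simp add: power2_eq_square)
    then have "\<epsilon> / 2 * n < card X" using n0 by simp
    moreover have "real m \<le> real b" using b by simp
    moreover have "\<epsilon> / 2 * n = (n * \<epsilon>) / 2" by simp
    ultimately have "real m \<le> real (card X)" using n' by linarith
    then have mX: "m \<le> card X" by simp
    obtain M where M: "M \<subseteq> X" "card M = m" "finite M"
      by (rule obtain_subset_with_card_n[OF mX])
    define Y where "Y = {y \<in> {..<n}. t \<le> card {x \<in> M. {x, y} \<in> G}}"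
    have cM: "card {x \<in> M. {x, y} \<in> G} \<le> m" for y
      unfolding M(2)[symmetric] by (intro card_mono M(3)) auto
    have "m * (\<epsilon> / 2 * n) = (\<Sum>x\<in>M. \<epsilon> / 2 * n)" using M by simp
    also have "\<dots> \<le> (\<Sum>x\<in>M. real (card (?N x)))" using M by (intro sum_mono) (auto simp: X_def)
    also have "\<dots> = (\<Sum>y<n. real (card {x \<in> M. {x, y} \<in> G}))"
      using sum_multicount_gen[OF M(3), of "{..<n}" "\<lambda>x y. {x, y} \<in> G" "\<lambda>y. card {x \<in> M. {x, y} \<in> G}"]
      by (simp flip: of_nat_sum)
    also have "\<dots> \<le> (\<Sum>y<n. (if y \<in> Y then real m else 0) + t)"
      using cM by (intro sum_mono) (auto simp: Y_def add_increasing2)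
    also have "\<dots> = card Y * m + real t * n"
      by (simp add: sum.distrib Y_def flip: sum.inter_filter)
    finally have 1: "m * (\<epsilon> / 2 * n) \<le> card Y * m + real t * n" .
    have "4 * real t * n \<le> m * \<epsilon> * n" using m n0 by (intro mult_right_mono) auto
    then have "m * (\<epsilon> / 4 * n) \<le> m * real (card Y)" using 1 by (simp add: algebra_simps)
    then have Y: "\<epsilon> / 4 * n \<le> card Y" using m0 by simp
    have "\<exists>S\<in>Pow M. \<not> card {y \<in> Y. {x \<in> M. {x, y} \<in> G} = S} \<le> t"
    proof (rule ccontr)
      assume "\<not> ?thesis"
      then have "card Y \<le> card (Pow M) * t"
        by (intro card_le_fibers[where f = "\<lambda>y. {x \<in> M. {x, y} \<in> G}"]) (use M in auto)
      then have "real (card Y) \<le> real (2 ^ m * t)" using M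
        by (simp only: card_Pow of_nat_le_iff)
      also have "\<dots> \<le> real b" using b by (simp only: of_nat_le_iff)
      finally have "4 * real (card Y) + 1 \<le> n * \<epsilon>" using n' by linarith
      then show False using Y by (simp add: mult.commute)
    qed
    then obtain S where S: "S \<subseteq> M" "t < card {y \<in> Y. {x \<in> M. {x, y} \<in> G} = S}" by auto
    define W where "W = {y \<in> Y. {x \<in> M. {x, y} \<in> G} = S}"
    have tW: "t < card W" using S(2) unfolding W_def .
    \<comment> \<open>Any member of \<open>W\<close> lies in \<open>Y\<close> and has trace
      \<open>S\<close> on \<open>M\<close>; this gives \<open>t \<le> card S\<close>.\<close>
    then have "W \<noteq> {}" by auto
    then obtain y where "y \<in> W" by blast
    then have "t \<le> card {x \<in> M. {x, y} \<in> G}" and eq: "{x \<in> M. {x, y} \<in> G} = S"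
      unfolding W_def Y_def by blast+
    then have "t \<le> card S" unfolding eq by simp
    moreover have "S \<subseteq> {..<n}" using S M by (auto simp: X_def)
    moreover have "W \<subseteq> {..<n}" "t \<le> card W" using tW by (auto simp: W_def Y_def)
    moreover have "{x, y} \<in> G" if "x \<in> S" "y \<in> W" for x y using that unfolding W_def by blast
    ultimately show "contains_copy V E n G"
      unfolding t_def by (intro complete_bipartite_contains_copy[OF F, of c S n W] c col host) auto
  qed
qed

subsection \<open>Heavy pairs and Berge copies\<close>

text \<open>The value used for \<open>m\<close> is \<open>card E\<close>: then a heavy pair keeps a
  free hyperedge even when all other edges of \<open>F\<close> have taken theirs.\<close>

definition heavy_pairs :: "nat \<Rightarrow> nat set set \<Rightarrow> nat set set" where
  "heavy_pairs m H = {p. card p = 2 \<and> m \<le> card {h \<in> H. p \<subseteq> h}}"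

text \<open>Edges of the copy that lie in \<open>L\<close> receive their hyperedges from
  \<open>g\<close>. The remaining edges are heavy and are served greedily, avoiding the hyperedges
  in use.\<close>

lemma contains_berge_if_copy:
  assumes F: "graph_on V E"
    and g: "inj_on g L" "\<And>p. p \<in> L \<Longrightarrow> g p \<in> H \<and> p \<subseteq> g p"
    and copy: "contains_copy V E n (heavy_pairs (card E) H \<union> L)"
  shows "contains_berge V E n H"
proof -
  obtain \<phi> where \<phi>: "inj_on \<phi> V" "\<phi> ` V \<subseteq> {..<n}"
    "\<And>e. e \<in> E \<Longrightarrow> \<phi> ` e \<in> heavy_pairs (card E) H \<union> L"
    using copy unfolding contains_copy_def by blast
  have EV: "E \<subseteq> Pow V" and finE: "finite E"
    using F finite_subset[of E "Pow V"] by (auto simp: graph_on_def)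
  define E1 where "E1 = {e \<in> E. \<phi> ` e \<in> L}"
  define g1 where "g1 = (\<lambda>e. g (\<phi> ` e))"
  have E1: "E1 \<subseteq> E" "finite E1" using finE by (auto simp: E1_def)
  have inj: "inj_on ((`) \<phi>) E" using \<phi>(1) EV by (meson inj_on_image_Pow inj_on_subset)
  have inj1: "inj_on g1 E1"
    using inj g(1) by (auto simp: g1_def inj_on_def E1_def)
  \<comment> \<open>Hyperedges in use and edges still to be served together number at most
    \<open>card E\<close>, the threshold for heaviness.\<close>
  have "card (g1 ` E1) + card (E - E1) \<le> card {h \<in> H. \<phi> ` e \<subseteq> h}" if "e \<in> E - E1" for e
  proof -
    have "card (g1 ` E1) \<le> card E1" using E1 by (intro card_image_le)
    moreover have "card E = card E1 + card (E - E1)"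
      using E1 finE by (metis card_Diff_subset card_mono le_add_diff_inverse)
    moreover have "card E \<le> card {h \<in> H. \<phi> ` e \<subseteq> h}"
      using that \<phi>(3)[of e] by (auto simp: E1_def heavy_pairs_def)
    ultimately show ?thesis by linarith
  qed
  then obtain f where f: "inj_on f (E - E1)" "\<forall>e\<in>E - E1. f e \<in> {h \<in> H. \<phi> ` e \<subseteq> h} - g1 ` E1"
    using greedy_representatives[of "E - E1" "g1 ` E1" "\<lambda>e. {h \<in> H. \<phi> ` e \<subseteq> h}"] finE E1 by blast
  define k where "k e = (if e \<in> E1 then g1 e else f e)" for e
  have "inj_on k E"
  proof -
    have "inj_on k E1" using inj1 by (rule inj_on_cong[THEN iffD1, rotated]) (simp add: k_def)
    moreover have "inj_on k (E - E1)" using f(1) by (rule inj_on_cong[THEN iffD1, rotated]) (simp add: k_def)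
    moreover have "k ` E1 \<subseteq> g1 ` E1" "k ` (E - E1) \<inter> g1 ` E1 = {}"
      using f(2) by (auto simp: k_def)
    then have "k ` (E1 - (E - E1)) \<inter> k ` (E - E1 - E1) = {}" by blast
    ultimately have "inj_on k (E1 \<union> (E - E1))" by (simp only: inj_on_Un simp_thms)
    moreover have "E1 \<union> (E - E1) = E" using E1 by blast
    ultimately show ?thesis by simp
  qed
  moreover have "k e \<in> H \<and> \<phi> ` e \<subseteq> k e" if "e \<in> E" for e
    using that f(2) g(2)[of "\<phi> ` e"] by (cases "e \<in> E1") (auto simp: k_def g1_def E1_def)
  ultimately show ?thesis unfolding contains_berge_def using \<phi>(1,2) by blast
qed

lemma clique_contains_copy:
  assumes F: "graph_on V E" and K: "K \<subseteq> {..<n}" "card V \<le> card K" "pairs K \<subseteq> G"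
  shows "contains_copy V E n G"
proof -
  have finV: "finite V" "finite K" using F K finite_subset by (auto simp: graph_on_def)
  obtain f where f: "inj_on f V" "f ` V \<subseteq> K" using inj_on_iff_card_le[OF finV] K by auto
  have "f ` e \<in> G" if "e \<in> E" for e
  proof -
    have "e \<subseteq> V" "card e = 2" using F that by (auto simp: graph_on_def)
    then have "f ` e \<in> pairs K"
      using f card_image[of f e] inj_on_subset[of f V e] by (auto simp: pairs_def)
    then show ?thesis using K by blast
  qed
  then show ?thesis unfolding contains_copy_def using f K by blast
qed

text \<open>Without a mixed triangle, adjacency in \<open>G\<close> is transitive, so each closed
  neighbourhood \<open>K x\<close> is a clique of size at most \<open>k\<close>. Two of them cannot
  cover \<open>h\<close>, which leaves three points that are pairwise nonadjacent.\<close>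

lemma mixed_or_empty_triple:
  assumes fin: "finite h" and big: "2 * k < card h"
    and clique: "\<And>K. K \<subseteq> h \<Longrightarrow> pairs K \<subseteq> G \<Longrightarrow> card K \<le> k"
  shows "(\<exists>T\<subseteq>h. card T = 3 \<and> pairs T \<inter> G = {})
    \<or> (\<exists>u v w. {u, v, w} \<subseteq> h \<and> u \<noteq> v \<and> {u, v} \<notin> G \<and> u \<noteq> w \<and> {u, w} \<in> G \<and> v \<noteq> w \<and> {v, w} \<in> G)"
proof (rule disjCI)
  assume no: "\<not> (\<exists>u v w. {u, v, w} \<subseteq> h \<and> u \<noteq> v \<and> {u, v} \<notin> G \<and> u \<noteq> w \<and> {u, w} \<in> G \<and> v \<noteq> w \<and> {v, w} \<in> G)"
  define K where "K x = insert x {y \<in> h. y \<noteq> x \<and> {x, y} \<in> G}" for x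
  have Kh: "K x \<subseteq> h" if "x \<in> h" for x using that by (auto simp: K_def)
  have cK: "card (K x) \<le> k" if x: "x \<in> h" for x
  proof (rule clique[OF Kh[OF x]], rule subsetI)
    fix p assume "p \<in> pairs (K x)"
    then obtain u v where uv: "u \<in> K x" "v \<in> K x" "u \<noteq> v" "p = {u, v}" by (rule pairsE)
    show "p \<in> G"
    proof (cases "u = x \<or> v = x")
      case True
      then show ?thesis using uv by (auto simp: K_def insert_commute)
    next
      case False
      then have "{u, v, x} \<subseteq> h" "u \<noteq> x" "{u, x} \<in> G" "v \<noteq> x" "{v, x} \<in> G"
        using uv x by (auto simp: K_def insert_commute)
      then show ?thesis using no uv by blast
    qed
  qed
  have "h \<noteq> {}" using big by auto
  then obtain x where x: "x \<in> h" by blast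
  have "\<not> h \<subseteq> K x" using cK[OF x] big card_mono[of "K x" h] Kh[OF x] fin finite_subset by fastforce
  then obtain y where y: "y \<in> h" "y \<notin> K x" by blast
  have "\<not> h \<subseteq> K x \<union> K y"
  proof
    assume "h \<subseteq> K x \<union> K y"
    then have "card h \<le> card (K x \<union> K y)"
      using Kh[OF x] Kh[OF y(1)] fin by (intro card_mono) (auto intro: finite_subset)
    also have "\<dots> \<le> card (K x) + card (K y)" by (rule card_Un_le)
    finally show False using cK[OF x] cK[OF y(1)] big by linarith
  qed
  then obtain z where z: "z \<in> h" "z \<notin> K x" "z \<notin> K y" by blast
  have d: "x \<noteq> y" "x \<noteq> z" "y \<noteq> z" "{x, y} \<notin> G" "{x, z} \<notin> G" "{y, z} \<notin> G"
    using x y z by (auto simp: K_def)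
  have "pairs {x, y, z} \<inter> G = {}" using d by (auto elim!: pairsE simp: insert_commute)
  moreover have "card {x, y, z} = 3" using d by simp
  ultimately show "\<exists>T\<subseteq>h. card T = 3 \<and> pairs T \<inter> G = {}"
    using x y z by (intro exI[of _ "{x, y, z}"]) simp
qed

subsection \<open>Hyperedges with a mixed triangle\<close>

text \<open>Positivity of \<open>m\<close> places every heavy pair in some hyperedge, hence inside
  \<open>{..<n}\<close>.\<close>

lemma host_graph_heavy:
  assumes "uniform_hypergraph r n H" "0 < m" shows "host_graph n (heavy_pairs m H)"
  unfolding host_graph_def
proof (intro ballI conjI)
  fix p assume p: "p \<in> heavy_pairs m H"
  then show "card p = 2" by (simp add: heavy_pairs_def)
  have "{h \<in> H. p \<subseteq> h} \<noteq> {}" using p assms(2) by (auto simp: heavy_pairs_def simp del: Collect_empty_eq)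
  then show "p \<subseteq> {..<n}" using assms(1) by (auto simp: uniform_hypergraph_def)
qed

lemma finite_uniform_hypergraph: "uniform_hypergraph r n H \<Longrightarrow> finite H"
  by (rule finite_subset[of _ "Pow {..<n}"]) (auto simp: uniform_hypergraph_def)

text \<open>A light pair lies in fewer than \<open>m\<close> hyperedges, so it is selected by few of
  them and at most a factor \<open>m\<close> is lost. Inverting \<open>p\<close> on its image
  assigns distinct hyperedges to the selected pairs, as \<open>contains_berge_if_copy\<close>
  requires.\<close>

lemma light_representatives:
  assumes fin: "finite H" and sub: "H1 \<subseteq> H"
    and p: "\<forall>h\<in>H1. p h \<subseteq> h \<and> card (p h) = 2 \<and> p h \<notin> heavy_pairs m H"
  shows "card H1 \<le> card (p ` H1) * m" "inj_on (inv_into H1 p) (p ` H1)"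
    "\<And>e. e \<in> p ` H1 \<Longrightarrow> inv_into H1 p e \<in> H1 \<and> p (inv_into H1 p e) = e \<and> e \<subseteq> inv_into H1 p e"
proof -
  have fin1: "finite H1" using fin sub finite_subset by blast
  show "card H1 \<le> card (p ` H1) * m"
  proof (rule card_le_fibers[where f = p])
    fix e assume "e \<in> p ` H1"
    then obtain h where h: "h \<in> H1" "e = p h" by blast
    have "card {a \<in> H1. p a = e} \<le> card {a \<in> H. e \<subseteq> a}"
      using fin sub p by (intro card_mono) auto
    also have "\<dots> \<le> m" using p h by (auto simp: heavy_pairs_def)
    finally show "card {a \<in> H1. p a = e} \<le> m" .
  qed (use fin1 in auto)
  show "inj_on (inv_into H1 p) (p ` H1)" by (rule inj_on_inv_into) simp
  fix e assume e: "e \<in> p ` H1"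
  have "inv_into H1 p e \<in> H1" "p (inv_into H1 p e) = e"
    using e by (simp_all add: inv_into_into f_inv_into_f)
  then show "inv_into H1 p e \<in> H1 \<and> p (inv_into H1 p e) = e \<and> e \<subseteq> inv_into H1 p e"
    using p by metis
qed

lemma host_graph_Un: "host_graph n A \<Longrightarrow> host_graph n B \<Longrightarrow> host_graph n (A \<union> B)"
  by (auto simp: host_graph_def)

text \<open>The selected light pairs and the heavy pairs form an \<open>F\<close>-free graph. Each
  selected pair lies in a triangle whose other sides are heavy, and one triangle arises from at most
  three pairs. The factor \<open>card E\<close> is the loss in passing from hyperedges to distinct
  pairs.\<close>

lemma card_mixed_hyperedges:
  assumes F: "graph_on V E" "E \<noteq> {}" and H: "uniform_hypergraph r n H" "\<not> contains_berge V E n H"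
    and sub: "H1 \<subseteq> H"
    and mixed: "\<And>h. h \<in> H1 \<Longrightarrow> \<exists>u v w. {u, v, w} \<subseteq> h \<and> u \<noteq> v \<and> {u, v} \<notin> heavy_pairs (card E) H \<and>
      u \<noteq> w \<and> {u, w} \<in> heavy_pairs (card E) H \<and> v \<noteq> w \<and> {v, w} \<in> heavy_pairs (card E) H"
  shows "card H1 \<le> 3 * card E * ex_K3 V E n"
proof -
  let ?P = "heavy_pairs (card E) H"
  have finE: "finite E" using F(1) finite_subset[of E "Pow V"] by (auto simp: graph_on_def)
  have m: "0 < card E" using F(2) finE by (simp add: card_gt_0_iff)
  have finH: "finite H" using H(1) by (rule finite_uniform_hypergraph)
  have "\<exists>p w. p \<subseteq> h \<and> card p = 2 \<and> p \<notin> ?P \<and> w \<in> h \<and> w \<notin> p \<and> (\<forall>x\<in>p. {x, w} \<in> ?P)"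
    if h: "h \<in> H1" for h
  proof -
    obtain u v w where "{u, v, w} \<subseteq> h" "u \<noteq> v" "{u, v} \<notin> ?P" "u \<noteq> w" "{u, w} \<in> ?P" "v \<noteq> w" "{v, w} \<in> ?P"
      using mixed[OF h] by blast
    then show ?thesis by (intro exI[of _ "{u, v}"] exI[of _ w]) auto
  qed
  then have "\<forall>h\<in>H1. \<exists>pw. fst pw \<subseteq> h \<and> card (fst pw) = 2 \<and> fst pw \<notin> ?P \<and>
      snd pw \<in> h \<and> snd pw \<notin> fst pw \<and> (\<forall>x\<in>fst pw. {x, snd pw} \<in> ?P)"
    by simp
  then obtain pw where pw: "\<forall>h\<in>H1. fst (pw h) \<subseteq> h \<and> card (fst (pw h)) = 2 \<and> fst (pw h) \<notin> ?P \<and>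
      snd (pw h) \<in> h \<and> snd (pw h) \<notin> fst (pw h) \<and> (\<forall>x\<in>fst (pw h). {x, snd (pw h)} \<in> ?P)"
    by (rule bchoice[THEN exE])
  define p where "p = fst \<circ> pw"
  define w where "w = snd \<circ> pw"
  have p': "\<forall>h\<in>H1. p h \<subseteq> h \<and> card (p h) = 2 \<and> p h \<notin> ?P"
    using pw by (simp add: p_def)
  note p = bspec[OF p']
  have w: "w h \<in> h \<and> w h \<notin> p h \<and> (\<forall>x\<in>p h. {x, w h} \<in> ?P)" if "h \<in> H1" for h
    using pw that by (simp add: p_def w_def)
  define L where "L = p ` H1"
  define g where "g = inv_into H1 p"
  note rep = light_representatives[OF finH sub p', folded L_def g_def]
  have finL: "finite L" using finH sub finite_subset unfolding L_def by blast
  have host: "host_graph n (?P \<union> L)"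
  proof (rule host_graph_Un[OF host_graph_heavy[OF H(1) m]])
    show "host_graph n L"
      using p sub H(1) by (fastforce simp: host_graph_def L_def uniform_hypergraph_def)
  qed
  have free: "\<not> contains_copy V E n (?P \<union> L)"
  proof
    assume "contains_copy V E n (?P \<union> L)"
    then have "contains_berge V E n H"
      using rep(3) sub by (intro contains_berge_if_copy[OF F(1) rep(2)]) auto
    then show False using H(2) by contradiction
  qed
  \<comment> \<open>The apex is taken from the representative hyperedge of \<open>e\<close>, where
    \<open>e\<close> is the selected pair and both remaining sides are heavy.\<close>
  define T where "T e = insert (w (g e)) e" for e
  have T: "T e \<in> triangle_set n (?P \<union> L)" if e: "e \<in> L" for e
  proof -
    define h where "h = g e"
    have h: "h \<in> H1" "p h = e" using rep(3)[OF e] by (auto simp: h_def)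
    obtain x y where xy: "e = {x, y}" "x \<noteq> y" using p[OF h(1)] h(2) by (auto simp: card_2_iff)
    have Te: "T e = {w h, x, y}" by (simp add: T_def h_def xy)
    have d: "w h \<noteq> x" "w h \<noteq> y" "{x, w h} \<in> ?P" "{y, w h} \<in> ?P" using w[OF h(1)] h(2) xy by auto
    have "T e \<subseteq> {..<n}"
      using p[OF h(1)] w[OF h(1)] h sub H(1) unfolding T_def uniform_hypergraph_def by (fold h_def) blast
    moreover have "card (T e) = 3" unfolding Te using d(1,2) xy(2) by simp
    moreover have "pairs (T e) \<subseteq> ?P \<union> L"
      unfolding Te using d e xy by (auto elim!: pairsE simp: insert_commute)
    ultimately show ?thesis by (simp add: triangle_set_def)
  qed
  have "card L \<le> card (triangle_set n (?P \<union> L)) * 3"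
  proof (rule card_le_fibers[where f = T])
    fix t assume t: "t \<in> triangle_set n (?P \<union> L)"
    then have "card t = 3" by (simp add: triangle_set_def)
    then have 3: "card (pairs t) = 3" by (rule card_pairs_triple)
    have "{e \<in> L. T e = t} \<subseteq> pairs t" using p by (auto simp: pairs_def T_def L_def)
    then have "card {e \<in> L. T e = t} \<le> card (pairs t)"
      using 3 by (intro card_mono) (auto intro: card_ge_0_finite)
    then show "card {e \<in> L. T e = t} \<le> 3" using 3 by simp
  qed (use T finite_triangle_set in auto)
  also have "\<dots> \<le> ex_K3 V E n * 3" using triangles_le_ex_K3[OF host free] by simp
  finally have "card L * card E \<le> ex_K3 V E n * 3 * card E" by (rule mult_right_mono) simp
  also have "\<dots> = 3 * card E * ex_K3 V E n" by simp
  finally show ?thesis using rep(1) by linarith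
qed

subsection \<open>Hyperedges with a light triangle\<close>

text \<open>The factor \<open>27 = 3^3\<close> crudely bounds the number of ordered triples with
  entries in a given triangle.\<close>

lemma card_ordered_triangles_le:
  assumes "host_graph n G"
  shows "card {(x, y, z) \<in> {..<n} \<times> {..<n} \<times> {..<n}. {x, y} \<in> G \<and> {x, z} \<in> G \<and> {y, z} \<in> G}
    \<le> card (triangle_set n G) * 27"
proof -
  let ?O = "{(x, y, z) \<in> {..<n} \<times> {..<n} \<times> {..<n}. {x, y} \<in> G \<and> {x, z} \<in> G \<and> {y, z} \<in> G}"
  let ?f = "\<lambda>(x, y, z). {x, y, z}"
  have neq: "x \<noteq> y" if "{x, y} \<in> G" for x y using assms that by (force simp: host_graph_def)
  show ?thesis
  proof (rule card_le_fibers[where f = ?f])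
    show "?f ` ?O \<subseteq> triangle_set n G"
    proof
      fix T assume "T \<in> ?f ` ?O"
      then obtain x y z where T: "T = {x, y, z}" and xyz: "x < n" "y < n" "z < n"
        "{x, y} \<in> G" "{x, z} \<in> G" "{y, z} \<in> G" by auto
      then have d: "x \<noteq> y" "x \<noteq> z" "y \<noteq> z" using neq by blast+
      moreover have "pairs T \<subseteq> G" unfolding T using xyz by (auto elim!: pairsE simp: insert_commute)
      ultimately show "T \<in> triangle_set n G" using T xyz by (simp add: triangle_set_def)
    qed
    fix T assume "T \<in> triangle_set n G"
    then have T: "card T = 3" by (simp add: triangle_set_def)
    then have "finite T" by (intro card_ge_0_finite) simp
    moreover have "{a \<in> ?O. ?f a = T} \<subseteq> T \<times> T \<times> T" by auto
    ultimately have "card {a \<in> ?O. ?f a = T} \<le> card (T \<times> T \<times> T)" by (intro card_mono) auto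
    then show "card {a \<in> ?O. ?f a = T} \<le> 27" using T by (simp add: card_cartesian_product)
  qed (rule finite_triangle_set)
qed

lemma sorted_triple:
  assumes "card (T :: nat set) = 3" obtains x y z where "T = {x, y, z}" "x < y" "y < z"
proof -
  obtain a b c where T: "T = {a, b, c}" "a \<noteq> b" "a \<noteq> c" "b \<noteq> c" using assms by (auto simp: card_3_iff)
  then consider "a < b" "b < c" | "a < c" "c < b" | "b < a" "a < c" | "b < c" "c < a" | "c < a" "a < b" | "c < b" "b < a"
    by linarith
  then show ?thesis using T that by cases (auto simp: insert_commute)
qed

text \<open>The removal lemma for unordered triples: listing each triple increasingly reduces it to
  \<open>triangle_removal\<close>, and forgetting the order in the conclusion costs the factor
  27.\<close>

lemma triangle_removal_disjoint:
  assumes "0 < (\<epsilon>::real)"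
  shows "\<exists>\<delta>>0. \<forall>n \<T>. (\<forall>T\<in>\<T>. T \<subseteq> {..<n} \<and> card T = 3) \<longrightarrow>
    (\<forall>T\<in>\<T>. \<forall>T'\<in>\<T>. T \<noteq> T' \<longrightarrow> pairs T \<inter> pairs T' = {}) \<longrightarrow> \<epsilon> * (real n)\<^sup>2 < card \<T> \<longrightarrow>
    \<delta> * real n ^ 3 \<le> 27 * card (triangle_set n (\<Union>(pairs ` \<T>)))"
proof -
  obtain \<delta> where \<delta>: "0 < \<delta>" "\<And>(V :: nat set) R T. finite V \<Longrightarrow>
    (\<forall>(x, y, z)\<in>T. {x, y, z} \<subseteq> V \<and> (x, y) \<in> R \<and> (x, z) \<in> R \<and> (y, z) \<in> R) \<Longrightarrow>
    (\<forall>(x, y, z)\<in>T. \<forall>(x', y', z')\<in>T. (x, y, z) \<noteq> (x', y', z') \<longrightarrow>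
       {(x, y), (x, z), (y, z)} \<inter> {(x', y'), (x', z'), (y', z')} = {}) \<Longrightarrow>
    \<epsilon> * (real (card V))\<^sup>2 < card T \<Longrightarrow>
    \<delta> * real (card V) ^ 3 \<le> card {(x, y, z) \<in> V \<times> V \<times> V. (x, y) \<in> R \<and> (x, z) \<in> R \<and> (y, z) \<in> R}"
    using triangle_removal[OF assms, where 'a = nat] by blast
  show ?thesis
  proof (intro exI[of _ \<delta>] conjI allI impI \<delta>(1))
    fix n \<T>
    assume T: "\<forall>T\<in>\<T>. T \<subseteq> {..<n} \<and> card T = 3"
      and disj: "\<forall>T\<in>\<T>. \<forall>T'\<in>\<T>. T \<noteq> T' \<longrightarrow> pairs T \<inter> pairs T' = {}"
      and large: "\<epsilon> * (real n)\<^sup>2 < card \<T>"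
    have disj': "T = T'" if "p \<in> pairs T" "p \<in> pairs T'" "T \<in> \<T>" "T' \<in> \<T>" for p T T'
      using disj that by blast
    define G where "G = \<Union>(pairs ` \<T>)"
    \<comment> \<open>One ordering per triple, since different orderings of the same triangle can
      share ordered pairs and violate disjointness.\<close>
    define S where "S = {(x, y, z). x < y \<and> y < z \<and> {x, y, z} \<in> \<T>}"
    have host: "host_graph n G" using T by (fastforce simp: host_graph_def G_def pairs_def)
    have "\<T> \<subseteq> (\<lambda>(x, y, z). {x, y, z}) ` S"
    proof
      fix t assume t: "t \<in> \<T>"
      then obtain x y z where "t = {x, y, z}" "x < y" "y < z" using T sorted_triple[of t] by blast
      then have "(x, y, z) \<in> S" "t = (\<lambda>(x, y, z). {x, y, z}) (x, y, z)" using t by (simp_all add: S_def)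
      then show "t \<in> (\<lambda>(x, y, z). {x, y, z}) ` S" by (rule rev_image_eqI)
    qed
    moreover have "finite S"
      by (rule finite_subset[of _ "{..<n} \<times> {..<n} \<times> {..<n}"]) (use T in \<open>auto simp: S_def\<close>)
    ultimately have "card \<T> \<le> card S" by (rule surj_card_le[rotated])
    then have largeS: "\<epsilon> * (real (card {..<n}))\<^sup>2 < card S" using large by simp
    let ?R = "{(x, y). {x, y} \<in> G}"
    have G: "p \<in> G" if "{x, y, z} \<in> \<T>" "p \<in> pairs {x, y, z}" for x y z p
      using that by (auto simp: G_def)
    have "\<delta> * real (card {..<n}) ^ 3 \<le> card {(x, y, z) \<in> {..<n} \<times> {..<n} \<times> {..<n}.
        (x, y) \<in> ?R \<and> (x, z) \<in> ?R \<and> (y, z) \<in> ?R}"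
    proof (rule \<delta>(2)[OF _ _ _ largeS])
      show "\<forall>(x, y, z)\<in>S. {x, y, z} \<subseteq> {..<n} \<and> (x, y) \<in> ?R \<and> (x, z) \<in> ?R \<and> (y, z) \<in> ?R"
      proof (clarify, intro conjI)
        fix x y z assume s: "(x, y, z) \<in> S"
        then show "{x, y, z} \<subseteq> {..<n}" using T by (auto simp: S_def)
        show "(x, y) \<in> ?R" "(x, z) \<in> ?R" "(y, z) \<in> ?R"
          using s by (auto simp: S_def pairs_def intro!: G[of x y z])
      qed
      show "\<forall>(x, y, z)\<in>S. \<forall>(x', y', z')\<in>S. (x, y, z) \<noteq> (x', y', z') \<longrightarrow>
        {(x, y), (x, z), (y, z)} \<inter> {(x', y'), (x', z'), (y', z')} = {}"
      proof (intro ballI, unfold split_paired_all case_prod_conv, intro ballI,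
          unfold split_paired_all case_prod_conv, intro impI, rule ccontr)
        fix x y z x' y' z'
        assume s: "(x, y, z) \<in> S" "(x', y', z') \<in> S" and ne: "(x, y, z) \<noteq> (x', y', z')"
          and "{(x, y), (x, z), (y, z)} \<inter> {(x', y'), (x', z'), (y', z')} \<noteq> {}"
        then obtain a b where ab: "(a, b) \<in> {(x, y), (x, z), (y, z)}" "(a, b) \<in> {(x', y'), (x', z'), (y', z')}"
          by auto
        have "{a, b} \<in> pairs {x, y, z}" using ab(1) s(1) by (auto simp: S_def pairs_def)
        moreover have "{a, b} \<in> pairs {x', y', z'}" using ab(2) s(2) by (auto simp: S_def pairs_def)
        moreover have "{x, y, z} \<in> \<T>" "{x', y', z'} \<in> \<T>" using s by (auto simp: S_def)
        ultimately have eq: "{x, y, z} = {x', y', z'}" by (rule disj')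
        have o: "x < y" "y < z" "x' < y'" "y' < z'" using s by (auto simp: S_def)
        have "x \<in> {x', y', z'}" "z \<in> {x', y', z'}" "y \<in> {x', y', z'}"
          "x' \<in> {x, y, z}" "z' \<in> {x, y, z}" using eq by blast+
        then have "x = x'" "z = z'" "y = y'" using o by auto
        then show False using ne by simp
      qed
    qed simp
    also have "\<dots> = card {(x, y, z) \<in> {..<n} \<times> {..<n} \<times> {..<n}. {x, y} \<in> G \<and> {x, z} \<in> G \<and> {y, z} \<in> G}"
      by simp
    also have "\<dots> \<le> card (triangle_set n G) * 27"
      using card_ordered_triangles_le[OF host] by (simp only: of_nat_le_iff)
    finally show "\<delta> * real n ^ 3 \<le> 27 * card (triangle_set n (\<Union>(pairs ` \<T>)))"
      by (simp add: G_def)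
  qed
qed

lemma contains_copy_mono:
  assumes "contains_copy V E n G" "G \<subseteq> G'" shows "contains_copy V E n G'"
  using assms unfolding contains_copy_def by (meson subsetD)

text \<open>A maximal set of hyperedges whose light triangles share no pair loses only a factor
  \<open>3 * card E\<close>. Every other triangle in the union of these light triangles shares at
  most one pair with each, so a suitable choice of one edge per light triangle keeps
  \<open>1/27\<close> of them; that choice is \<open>F\<close>-free and so has at most
  \<open>ex_K3 V E n\<close> triangles.\<close>

lemma card_light_triangle_hyperedges:
  assumes F: "graph_on V E" and H: "uniform_hypergraph r n H" "\<not> contains_berge V E n H"
    and sub: "H2 \<subseteq> H"
    and light: "\<forall>h\<in>H2. \<exists>T\<subseteq>h. card T = 3 \<and> pairs T \<inter> heavy_pairs (card E) H = {}"
  shows "\<exists>\<T>. (\<forall>T\<in>\<T>. T \<subseteq> {..<n} \<and> card T = 3) \<and>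
    (\<forall>T\<in>\<T>. \<forall>T'\<in>\<T>. T \<noteq> T' \<longrightarrow> pairs T \<inter> pairs T' = {}) \<and>
    card H2 \<le> 3 * card E * card \<T> \<and>
    card (triangle_set n (\<Union>(pairs ` \<T>))) \<le> n\<^sup>2 + 27 * ex_K3 V E n"
proof -
  let ?P = "heavy_pairs (card E) H"
  have finH: "finite H" using H(1) by (rule finite_uniform_hypergraph)
  have finH2: "finite H2" using finH sub finite_subset by blast
  have "\<forall>h\<in>H2. \<exists>T. T \<subseteq> h \<and> card T = 3 \<and> pairs T \<inter> ?P = {}" using light by blast
  then obtain t where t: "\<forall>h\<in>H2. t h \<subseteq> h \<and> card (t h) = 3 \<and> pairs (t h) \<inter> ?P = {}"
    by (rule bchoice[THEN exE])
  define B where "B h = pairs (t h)" for h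
  have B3: "card (B h) = 3" if "h \<in> H2" for h using t that by (auto simp: B_def intro!: card_pairs_triple)
  have finB: "finite (B h)" if "h \<in> H2" for h using B3[OF that] by (intro card_ge_0_finite) simp
  have Bne: "B h \<noteq> {}" if "h \<in> H2" for h using B3[OF that] by auto
  obtain S where S: "S \<subseteq> H2" "\<forall>x\<in>S. \<forall>y\<in>S. x \<noteq> y \<longrightarrow> \<not> B x \<inter> B y \<noteq> {}"
    "\<forall>x\<in>H2. \<exists>y\<in>S. x = y \<or> B x \<inter> B y \<noteq> {}"
    using maximal_independent_subset[OF finH2, of "\<lambda>x y. B x \<inter> B y \<noteq> {}"] by blast
  have finS: "finite S" using S finH2 finite_subset by blast
  have disj: "B x \<inter> B y = {}" if "x \<in> S" "y \<in> S" "x \<noteq> y" for x y using S(2) that by blast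
  have SH: "h \<in> H" "h \<in> H2" if "h \<in> S" for h using that S sub by auto
  have tS: "t h \<subseteq> h" "t h \<subseteq> {..<n}" "card (t h) = 3" if "h \<in> S" for h
  proof -
    show "t h \<subseteq> h" "card (t h) = 3" using t SH(2)[OF that] by simp_all
    moreover have "h \<subseteq> {..<n}" using H(1) SH(1)[OF that] by (simp add: uniform_hypergraph_def)
    ultimately show "t h \<subseteq> {..<n}" by simp
  qed
  have injt: "inj_on t S"
  proof (rule inj_onI, rule ccontr)
    fix x y assume xy: "x \<in> S" "y \<in> S" "t x = t y" "x \<noteq> y"
    have "B x \<inter> B y = {}" by (rule disj[OF xy(1,2,4)])
    moreover have "B x = B y" using xy(3) by (simp add: B_def)
    ultimately show False using Bne[OF SH(2)[OF xy(1)]] by simp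
  qed
  \<comment> \<open>Each of the three pairs of the triangle of \<open>y\<close> is light and lies in
    at most \<open>card E\<close> hyperedges.\<close>
  have conflict: "card {x \<in> H2. B x \<inter> B y \<noteq> {}} \<le> 3 * card E" if y: "y \<in> S" for y
  proof -
    have yH2: "y \<in> H2" using S y by blast
    have "{x \<in> H2. B x \<inter> B y \<noteq> {}} \<subseteq> (\<Union>p\<in>B y. {h \<in> H. p \<subseteq> h})"
    proof
      fix x assume x: "x \<in> {x \<in> H2. B x \<inter> B y \<noteq> {}}"
      then obtain p where p: "p \<in> B x" "p \<in> B y" by blast
      have "p \<subseteq> x" using p(1) t x by (auto simp: B_def pairs_def)
      then show "x \<in> (\<Union>p\<in>B y. {h \<in> H. p \<subseteq> h})" using x p sub by blast
    qed
    then have "card {x \<in> H2. B x \<inter> B y \<noteq> {}} \<le> card (\<Union>p\<in>B y. {h \<in> H. p \<subseteq> h})"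
      using finB[OF yH2] finH by (intro card_mono) auto
    also have "\<dots> \<le> (\<Sum>p\<in>B y. card {h \<in> H. p \<subseteq> h})" by (rule card_UN_le[OF finB[OF yH2]])
    also have "\<dots> \<le> (\<Sum>p\<in>B y. card E)"
    proof (rule sum_mono)
      fix p assume p: "p \<in> B y"
      then have "p \<notin> ?P" using t yH2 by (auto simp: B_def)
      moreover have "card p = 2" using p by (simp add: B_def pairs_def)
      ultimately show "card {h \<in> H. p \<subseteq> h} \<le> card E" by (simp add: heavy_pairs_def)
    qed
    also have "\<dots> = 3 * card E" using B3[OF yH2] by simp
    finally show ?thesis .
  qed
  \<comment> \<open>Maximality of \<open>S\<close> covers \<open>H2\<close> by conflict sets; a
    member of \<open>S\<close> lies in its own because \<open>B\<close> is nonempty.\<close>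
  have "H2 \<subseteq> (\<Union>y\<in>S. {x \<in> H2. B x \<inter> B y \<noteq> {}})"
  proof
    fix x assume x: "x \<in> H2"
    then obtain y where "y \<in> S" "x = y \<or> B x \<inter> B y \<noteq> {}" using S(3) by blast
    then show "x \<in> (\<Union>y\<in>S. {x \<in> H2. B x \<inter> B y \<noteq> {}})" using x Bne[OF x] by auto
  qed
  then have "card H2 \<le> card (\<Union>y\<in>S. {x \<in> H2. B x \<inter> B y \<noteq> {}})"
    using finS finH2 by (intro card_mono) auto
  also have "\<dots> \<le> (\<Sum>y\<in>S. card {x \<in> H2. B x \<inter> B y \<noteq> {}})" by (rule card_UN_le[OF finS])
  also have "\<dots> \<le> (\<Sum>y\<in>S. 3 * card E)" using conflict by (rule sum_mono)
  finally have cH2: "card H2 \<le> 3 * card E * card (t ` S)"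
    by (simp add: card_image[OF injt] mult.commute)

  define G where "G = (\<Union>h\<in>S. B h)"
  \<comment> \<open>The light triangles themselves are set aside, because they share three pairs
    with their own block; they are bounded by \<open>n^2\<close> below.\<close>
  define D where "D = triangle_set n G - t ` S"
  have finD: "finite D" using finite_triangle_set by (simp add: D_def)
  have "\<exists>a\<in>Pi\<^sub>E S B. card D \<le> 27 * card {T \<in> D. pairs T \<subseteq> a ` S}"
  proof (rule exists_good_transversal[OF finS finD])
    fix T assume T: "T \<in> D"
    then have T3: "card T = 3" by (simp add: D_def triangle_set_def)
    then show "card (pairs T) = 3" by (rule card_pairs_triple)
    show "pairs T \<subseteq> (\<Union>h\<in>S. B h)" using T by (simp add: D_def triangle_set_def G_def)
    fix h assume h: "h \<in> S"
    then have "T \<noteq> t h" using T by (auto simp: D_def)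
    moreover have "card (t h) = 3" using t SH(2)[OF h] by blast
    ultimately show "card (pairs T \<inter> B h) \<le> 1"
      unfolding B_def using T3 by (intro two_pairs_determine_triple)
  qed (use B3 SH disj in auto)
  then obtain a where a: "a \<in> Pi\<^sub>E S B" "card D \<le> 27 * card {T \<in> D. pairs T \<subseteq> a ` S}"
    by (elim bexE)
  have aB: "a h \<in> B h" if "h \<in> S" for h using a(1) that by (auto simp: PiE_iff)
  have "inj_on a S" using aB disj by (intro inj_onI) (metis disjoint_iff)
  have "host_graph n (a ` S)"
    unfolding host_graph_def
  proof
    fix e assume "e \<in> a ` S"
    then obtain h where h: "h \<in> S" "e = a h" by blast
    then show "e \<subseteq> {..<n} \<and> card e = 2"
      using aB[OF h(1)] tS[OF h(1)] by (auto simp: B_def pairs_def)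
  qed
  moreover have "\<not> contains_copy V E n (a ` S)"
  proof
    assume "contains_copy V E n (a ` S)"
    then have "contains_copy V E n (?P \<union> a ` S)" by (rule contains_copy_mono) simp
    then have "contains_berge V E n H"
    proof (rule contains_berge_if_copy[OF F, rotated 2])
      show "inj_on (inv_into S a) (a ` S)" by (rule inj_on_inv_into) simp
      fix p assume "p \<in> a ` S"
      then have "inv_into S a p \<in> S" "a (inv_into S a p) = p"
        by (simp_all add: inv_into_into f_inv_into_f)
      then show "inv_into S a p \<in> H \<and> p \<subseteq> inv_into S a p"
        using aB[of "inv_into S a p"] tS[of "inv_into S a p"] SH(1)[of "inv_into S a p"]
        by (auto simp: B_def pairs_def)
    qed
    then show False using H(2) by contradiction
  qed
  ultimately have "card (triangle_set n (a ` S)) \<le> ex_K3 V E n" by (rule triangles_le_ex_K3)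
  moreover have "card {T \<in> D. pairs T \<subseteq> a ` S} \<le> card (triangle_set n (a ` S))"
    by (intro card_mono finite_triangle_set) (auto simp: D_def triangle_set_def)
  ultimately have cD: "card D \<le> 27 * ex_K3 V E n" using a(2) by linarith
  \<comment> \<open>The chosen edges are distinct, so there are at most as many light triangles as
    pairs of points.\<close>
  have "a ` S \<subseteq> pairs {..<n}"
    using \<open>host_graph n (a ` S)\<close> by (auto simp: host_graph_def pairs_def)
  then have "card (a ` S) \<le> n\<^sup>2"
    using card_mono[OF finite_pairs, of "{..<n}" "a ` S"] card_pairs_le[of n] by fastforce
  then have "card (t ` S) \<le> n\<^sup>2" using \<open>inj_on a S\<close> injt by (simp add: card_image)
  moreover have "card (triangle_set n G) \<le> card (D \<union> t ` S)"
    using finD finS by (intro card_mono) (auto simp: D_def)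
  moreover have "card (D \<union> t ` S) \<le> card D + card (t ` S)" by (rule card_Un_le)
  ultimately have "card (triangle_set n G) \<le> n\<^sup>2 + 27 * ex_K3 V E n" using cD by linarith
  moreover have "G = \<Union>(pairs ` t ` S)" by (simp add: G_def B_def image_image)
  moreover have "\<forall>T\<in>t ` S. T \<subseteq> {..<n} \<and> card T = 3"
    using tS by simp
  moreover have "\<forall>T\<in>t ` S. \<forall>T'\<in>t ` S. T \<noteq> T' \<longrightarrow> pairs T \<inter> pairs T' = {}"
  proof (clarify del: equalityI)
    fix x y assume "x \<in> S" "y \<in> S" "t x \<noteq> t y"
    then show "pairs (t x) \<inter> pairs (t y) = {}" using disj[of x y] unfolding B_def by metis
  qed
  ultimately show ?thesis using cH2 by (intro exI[of _ "t ` S"]) simp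
qed

subsection \<open>Asymptotics and the threshold\<close>

text \<open>An injective colouring shows that the minimum in \<open>chromatic_number\<close> is
  attained.\<close>

lemma chromatic_coloring:
  assumes "graph_on V E"
  obtains c :: "'a \<Rightarrow> nat" where "\<And>v. v \<in> V \<Longrightarrow> c v < chromatic_number V E"
    "\<And>e u v. e \<in> E \<Longrightarrow> u \<in> e \<Longrightarrow> v \<in> e \<Longrightarrow> u \<noteq> v \<Longrightarrow> c u \<noteq> c v"
proof -
  let ?col = "\<lambda>k. \<exists>c :: 'a \<Rightarrow> nat. (\<forall>v\<in>V. c v < k) \<and>
    (\<forall>e\<in>E. \<forall>u\<in>e. \<forall>v\<in>e. u \<noteq> v \<longrightarrow> c u \<noteq> c v)"
  have "finite V" using assms by (simp add: graph_on_def)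
  then obtain f :: "'a \<Rightarrow> nat" and k where f: "f ` V = {i. i < k}" "inj_on f V"
    using finite_imp_inj_to_nat_seg by metis
  have "f u \<noteq> f v" if "e \<in> E" "u \<in> e" "v \<in> e" "u \<noteq> v" for e u v
  proof -
    have "u \<in> V" "v \<in> V" using assms that by (auto simp: graph_on_def)
    then show ?thesis using f(2) that(4) by (auto dest: inj_onD)
  qed
  moreover have "\<forall>v\<in>V. f v < k" using f(1) by auto
  ultimately have "?col k" by blast
  then have "?col (chromatic_number V E)" unfolding chromatic_number_def by (rule LeastI)
  then show ?thesis using that by blast
qed

lemma chromatic_number_ge_2:
  assumes "graph_on V E" "E \<noteq> {}" shows "2 \<le> chromatic_number V E"
proof -
  obtain c :: "'a \<Rightarrow> nat" where c: "\<And>v. v \<in> V \<Longrightarrow> c v < chromatic_number V E"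
    "\<And>e u v. e \<in> E \<Longrightarrow> u \<in> e \<Longrightarrow> v \<in> e \<Longrightarrow> u \<noteq> v \<Longrightarrow> c u \<noteq> c v"
    using chromatic_coloring[OF assms(1)] by metis
  obtain e where e: "e \<in> E" using assms by blast
  then have "card e = 2" "e \<subseteq> V" using assms(1) by (auto simp: graph_on_def)
  then obtain u v where uv: "e = {u, v}" "u \<noteq> v" "u \<in> V" "v \<in> V" by (auto simp: card_2_iff)
  then have "c u \<noteq> c v" using c(2)[OF e] by simp
  then show ?thesis using c(1)[OF uv(3)] c(1)[OF uv(4)] by linarith
qed

text \<open>A larger clique would contain \<open>F\<close>, and heavy edges alone extend to a Berge
  copy: the case of empty \<open>L\<close>.\<close>

lemma heavy_clique_card_less:
  assumes F: "graph_on V E" and H: "\<not> contains_berge V E n H"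
    and K: "K \<subseteq> {..<n}" "pairs K \<subseteq> heavy_pairs (card E) H"
  shows "card K < card V"
proof (rule ccontr)
  assume "\<not> ?thesis"
  then have "contains_copy V E n (heavy_pairs (card E) H \<union> {})"
    using K by (intro clique_contains_copy[OF F K(1)]) auto
  then have "contains_berge V E n H" by (rule contains_berge_if_copy[OF F, rotated 2]) auto
  then show False using H by contradiction
qed

lemma ex_berge_smalloI:
  assumes "\<And>c :: real. 0 < c \<Longrightarrow> \<forall>\<^sub>F n in sequentially. \<forall>H. uniform_hypergraph r n H \<longrightarrow>
    \<not> contains_berge V E n H \<longrightarrow> card H \<le> c * (real n)\<^sup>2"
  shows "(\<lambda>n. real (ex_berge V E r n)) \<in> o(\<lambda>n. real n ^ 2)"
proof (rule landau_o.smallI)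
  fix c :: real assume c: "0 < c"
  show "\<forall>\<^sub>F n in sequentially. norm (real (ex_berge V E r n)) \<le> c * norm (real n ^ 2)"
    using assms[OF c]
  proof eventually_elim
    case (elim n)
    have "real (ex_berge V E r n) \<le> c * (real n)\<^sup>2"
      unfolding ex_berge_def using elim c by (intro real_Sup_nat_le) auto
    then show ?case by simp
  qed
qed

section \<open>Edgeless, bipartite and non-bipartite graphs\<close>

text \<open>Without edges, any injection of the vertices is a Berge copy, so no admissible
  hypergraph remains once \<open>card V \<le> n\<close>.\<close>

lemma ex_berge_smallo_edgeless:
  assumes "finite V" shows "(\<lambda>n. real (ex_berge V {} r n)) \<in> o(\<lambda>n. real n ^ 2)"
proof (rule ex_berge_smalloI)
  fix c :: real
  have "contains_berge V {} n H" if "card V \<le> n" for n H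
    using that inj_on_iff_card_le[OF assms, of "{..<n}"] by (auto simp: contains_berge_def)
  then show "\<forall>\<^sub>F n in sequentially. \<forall>H. uniform_hypergraph r n H \<longrightarrow>
      \<not> contains_berge V {} n H \<longrightarrow> card H \<le> c * (real n)\<^sup>2"
    unfolding eventually_sequentially by (intro exI[of _ "card V"]) simp
qed

text \<open>A hyperedge has at least \<open>card V\<close> points and so cannot be a heavy clique.
  It contains a light pair, and the selected light pairs form an \<open>F\<close>-free, hence
  sparse, graph.\<close>

lemma ex_berge_smallo_bipartite:
  assumes F: "graph_on V E" "E \<noteq> {}" and chi: "chromatic_number V E = 2" and r: "card V \<le> r"
  shows "(\<lambda>n. real (ex_berge V E r n)) \<in> o(\<lambda>n. real n ^ 2)"
proof (rule ex_berge_smalloI)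
  fix c :: real assume c: "0 < c"
  have finE: "finite E" using F(1) finite_subset[of E "Pow V"] by (auto simp: graph_on_def)
  then have m: "0 < card E" using F(2) by (simp add: card_gt_0_iff)
  obtain col :: "'a \<Rightarrow> nat" where col: "\<And>v. v \<in> V \<Longrightarrow> col v < 2"
    "\<And>e u v. e \<in> E \<Longrightarrow> u \<in> e \<Longrightarrow> v \<in> e \<Longrightarrow> u \<noteq> v \<Longrightarrow> col u \<noteq> col v"
    using chromatic_coloring[OF F(1)] unfolding chi by metis
  \<comment> \<open>Dividing \<open>c\<close> by \<open>card E\<close> compensates for the loss in
    \<open>light_representatives\<close>.\<close>
  have "\<exists>N. \<forall>n\<ge>N. \<forall>G. host_graph n G \<longrightarrow> c / card E * (real n)\<^sup>2 < card G \<longrightarrow> contains_copy V E n G"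
  proof (rule dense_graph_contains_bipartite[OF F(1)])
    show "col v < 2" if "v \<in> V" for v by (rule col(1)[OF that])
    show "col u \<noteq> col v" if "e \<in> E" "u \<in> e" "v \<in> e" "u \<noteq> v" for e u v by (rule col(2)[OF that])
  qed (use c m in simp)
  then obtain N where N: "\<And>n G. N \<le> n \<Longrightarrow> host_graph n G \<Longrightarrow> c / card E * (real n)\<^sup>2 < card G \<Longrightarrow> contains_copy V E n G"
    by blast
  have "card H \<le> c * (real n)\<^sup>2" if n: "N \<le> n" and H: "uniform_hypergraph r n H" "\<not> contains_berge V E n H" for n H
  proof -
    let ?P = "heavy_pairs (card E) H"
    have finH: "finite H" using H(1) by (rule finite_uniform_hypergraph)
    have "\<exists>p. p \<subseteq> h \<and> card p = 2 \<and> p \<notin> ?P" if h: "h \<in> H" for h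
    proof -
      have h': "h \<subseteq> {..<n}" "card h = r" using H(1) h by (auto simp: uniform_hypergraph_def)
      have "\<not> pairs h \<subseteq> ?P" using heavy_clique_card_less[OF F(1) H(2) h'(1)] h'(2) r by auto
      then show ?thesis by (auto simp: pairs_def)
    qed
    then have "\<forall>h\<in>H. \<exists>p. p \<subseteq> h \<and> card p = 2 \<and> p \<notin> ?P" by blast
    then obtain p where p: "\<forall>h\<in>H. p h \<subseteq> h \<and> card (p h) = 2 \<and> p h \<notin> ?P"
      by (rule bchoice[THEN exE])
    note rep = light_representatives[OF finH subset_refl p]
    have "host_graph n (p ` H)"
      using p H(1) by (fastforce simp: host_graph_def uniform_hypergraph_def)
    moreover have "\<not> contains_copy V E n (p ` H)"
    proof
      assume "contains_copy V E n (p ` H)"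
      then have "contains_copy V E n (?P \<union> p ` H)" by (rule contains_copy_mono) simp
      then have "contains_berge V E n H"
        using rep(3) by (intro contains_berge_if_copy[OF F(1) rep(2)]) auto
      then show False using H(2) by contradiction
    qed
    ultimately have "card (p ` H) \<le> c / card E * (real n)\<^sup>2" using N[OF n] by fastforce
    then have "card (p ` H) * real (card E) \<le> c / card E * (real n)\<^sup>2 * card E"
      by (intro mult_right_mono) auto
    then have "card (p ` H) * real (card E) \<le> c * (real n)\<^sup>2" using m by simp
    moreover have "real (card H) \<le> card (p ` H) * real (card E)"
      using rep(1) by (metis of_nat_le_iff of_nat_mult)
    ultimately show ?thesis by linarith
  qed
  then show "\<forall>\<^sub>F n in sequentially. \<forall>H. uniform_hypergraph r n H \<longrightarrow>
      \<not> contains_berge V E n H \<longrightarrow> card H \<le> c * (real n)\<^sup>2"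
    unfolding eventually_sequentially by (intro exI[of _ N]) simp
qed

text \<open>The bound on \<open>r\<close> lets \<open>mixed_or_empty_triple\<close> apply with
  \<open>k = card V - 1\<close>, so every hyperedge contains a light triangle or a mixed one. The
  two kinds of hyperedges are bounded separately.\<close>

lemma ex_berge_smallo_nonbipartite:
  assumes F: "graph_on V E" "E \<noteq> {}" and ex: "(\<lambda>n. real (ex_K3 V E n)) \<in> o(\<lambda>n. real n ^ 2)"
    and r: "2 * (card V - 1) < r"
  shows "(\<lambda>n. real (ex_berge V E r n)) \<in> o(\<lambda>n. real n ^ 2)"
proof (rule ex_berge_smalloI)
  fix c :: real assume c: "0 < c"
  have finE: "finite E" using F(1) finite_subset[of E "Pow V"] by (auto simp: graph_on_def)
  then have m: "0 < real (card E)" using F(2) by (simp add: card_gt_0_iff)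
  \<comment> \<open>Either kind of hyperedge costs a factor \<open>3 * card E\<close> and is
    allotted \<open>c / 2\<close>.\<close>
  define \<epsilon> where "\<epsilon> = c / (6 * card E)"
  have \<epsilon>: "0 < \<epsilon>" using c m by (simp add: \<epsilon>_def)
  obtain \<delta> where \<delta>: "0 < \<delta>" "\<And>n \<T>. \<forall>T\<in>\<T>. T \<subseteq> {..<n} \<and> card T = 3 \<Longrightarrow>
    \<forall>T\<in>\<T>. \<forall>T'\<in>\<T>. T \<noteq> T' \<longrightarrow> pairs T \<inter> pairs T' = {} \<Longrightarrow> \<epsilon> * (real n)\<^sup>2 < card \<T> \<Longrightarrow>
    \<delta> * real n ^ 3 \<le> 27 * card (triangle_set n (\<Union>(pairs ` \<T>)))"
    using triangle_removal_disjoint[OF \<epsilon>] by blast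
  \<comment> \<open>The bound by \<open>\<epsilon>\<close> handles mixed triangles; the bound by 1
    keeps the triangle count of the light part quadratic.\<close>
  have "\<forall>\<^sub>F n in sequentially. norm (real (ex_K3 V E n)) \<le> min \<epsilon> 1 * norm (real n ^ 2)"
    using ex \<epsilon> by (intro landau_o.smallD) auto
  \<comment> \<open>Here \<open>756 = 27 * (1 + 27)\<close>: the factor 27 of
    \<open>triangle_removal_disjoint\<close> times the coefficient of \<open>n^2\<close> in the
    triangle count.\<close>
  moreover have "\<forall>\<^sub>F n in sequentially. 756 / \<delta> < real n"
    using filterlim_real_sequentially by (simp add: filterlim_at_top_dense)
  ultimately show "\<forall>\<^sub>F n in sequentially. \<forall>H. uniform_hypergraph r n H \<longrightarrow>
      \<not> contains_berge V E n H \<longrightarrow> card H \<le> c * (real n)\<^sup>2"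
  proof eventually_elim
    case (elim n)
    have n756: "756 < \<delta> * n" using elim(2) \<delta>(1) by (simp add: field_simps)
    then have n0: "0 < real n" using \<delta>(1) by (cases n) auto
    have exn: "real (ex_K3 V E n) \<le> \<epsilon> * (real n)\<^sup>2" "real (ex_K3 V E n) \<le> 1 * (real n)\<^sup>2"
    proof -
      have "real (ex_K3 V E n) \<le> min \<epsilon> 1 * (real n)\<^sup>2" using elim(1) by simp
      then show "real (ex_K3 V E n) \<le> \<epsilon> * (real n)\<^sup>2" "real (ex_K3 V E n) \<le> 1 * (real n)\<^sup>2"
        by (meson order_trans mult_right_mono min.cobounded1 min.cobounded2 zero_le_power2)+
    qed
    show ?case
    proof (intro allI impI)
      fix H assume H: "uniform_hypergraph r n H" "\<not> contains_berge V E n H"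
      let ?P = "heavy_pairs (card E) H"
      define H2 where "H2 = {h \<in> H. \<exists>T\<subseteq>h. card T = 3 \<and> pairs T \<inter> ?P = {}}"
      have finH: "finite H" using H(1) by (rule finite_uniform_hypergraph)
      have "card (H - H2) \<le> 3 * card E * ex_K3 V E n"
      proof (rule card_mixed_hyperedges[OF F H])
        fix h assume h: "h \<in> H - H2"
        have h': "h \<subseteq> {..<n}" "card h = r" using H(1) h by (auto simp: uniform_hypergraph_def)
        have "finite h" using h'(1) finite_subset by blast
        moreover have "2 * (card V - 1) < card h" using h'(2) r by simp
        moreover have "card K \<le> card V - 1" if "K \<subseteq> h" "pairs K \<subseteq> ?P" for K
          using heavy_clique_card_less[OF F(1) H(2) _ that(2)] that(1) h'(1) by force
        ultimately have "(\<exists>T\<subseteq>h. card T = 3 \<and> pairs T \<inter> ?P = {}) \<or> (\<exists>u v w. {u, v, w} \<subseteq> h \<and> u \<noteq> v \<and>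
          {u, v} \<notin> ?P \<and> u \<noteq> w \<and> {u, w} \<in> ?P \<and> v \<noteq> w \<and> {v, w} \<in> ?P)"
          by (rule mixed_or_empty_triple)
        moreover have "\<not> (\<exists>T\<subseteq>h. card T = 3 \<and> pairs T \<inter> ?P = {})" using h unfolding H2_def by blast
        ultimately show "\<exists>u v w. {u, v, w} \<subseteq> h \<and> u \<noteq> v \<and>
          {u, v} \<notin> ?P \<and> u \<noteq> w \<and> {u, w} \<in> ?P \<and> v \<noteq> w \<and> {v, w} \<in> ?P" by (simp only: simp_thms)
      qed simp
      then have "real (card (H - H2)) \<le> 3 * card E * real (ex_K3 V E n)"
        by (metis of_nat_le_iff of_nat_mult of_nat_numeral)
      also have "\<dots> \<le> 3 * card E * (\<epsilon> * (real n)\<^sup>2)" using exn(1) by (intro mult_left_mono) auto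
      also have "\<dots> = c / 2 * (real n)\<^sup>2" using m by (simp add: \<epsilon>_def)
      finally have 1: "real (card (H - H2)) \<le> c / 2 * (real n)\<^sup>2" .
      have "H2 \<subseteq> H" "\<forall>h\<in>H2. \<exists>T\<subseteq>h. card T = 3 \<and> pairs T \<inter> ?P = {}" by (simp_all add: H2_def)
      from card_light_triangle_hyperedges[OF F(1) H this]
      obtain \<T> where T: "\<forall>T\<in>\<T>. T \<subseteq> {..<n} \<and> card T = 3"
        "\<forall>T\<in>\<T>. \<forall>T'\<in>\<T>. T \<noteq> T' \<longrightarrow> pairs T \<inter> pairs T' = {}"
        "card H2 \<le> 3 * card E * card \<T>"
        "card (triangle_set n (\<Union>(pairs ` \<T>))) \<le> n\<^sup>2 + 27 * ex_K3 V E n" by (elim exE conjE)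
      \<comment> \<open>More edge-disjoint triangles would force a cubic number of triangles, but
        their union has only quadratically many.\<close>
      have "card \<T> \<le> \<epsilon> * (real n)\<^sup>2"
      proof (rule ccontr)
        assume "\<not> ?thesis"
        then have "\<delta> * real n ^ 3 \<le> 27 * card (triangle_set n (\<Union>(pairs ` \<T>)))"
          using \<delta>(2)[OF T(1,2)] by simp
        also have "\<dots> \<le> 27 * real (n\<^sup>2 + 27 * ex_K3 V E n)"
          using of_nat_mono[OF T(4), where 'a = real] by simp
        also have "\<dots> \<le> 756 * (real n)\<^sup>2" using exn(2) by simp
        also have "\<dots> < (\<delta> * n) * (real n)\<^sup>2" using n756 n0 by (intro mult_strict_right_mono) auto
        also have "\<dots> = \<delta> * real n ^ 3" by (simp add: power2_eq_square power3_eq_cube)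
        finally show False by simp
      qed
      then have "3 * real (card E) * card \<T> \<le> 3 * real (card E) * (\<epsilon> * (real n)\<^sup>2)"
        by (intro mult_left_mono) auto
      also have "\<dots> = c / 2 * (real n)\<^sup>2" using m by (simp add: \<epsilon>_def)
      finally have 2: "3 * real (card E) * card \<T> \<le> c / 2 * (real n)\<^sup>2" .
      have "real (card H2) \<le> 3 * real (card E) * card \<T>"
        using T(3) by (metis of_nat_le_iff of_nat_mult of_nat_numeral)
      moreover have "card H \<le> card (H - H2) + card H2"
        using card_Un_le[of "H - H2" H2] by (simp add: H2_def Un_absorb2 Un_commute Int_absorb1)
      ultimately show "card H \<le> c * (real n)\<^sup>2" using 1 2 by linarith
    qed
  qed
qed

text \<open>As \<open>threshold\<close> is a minimum, it suffices to treat every \<open>r\<close>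
  from the claimed bound on, separately for edgeless graphs, chromatic number 2 and chromatic number
  at least 3.\<close>

theorem theorem5:
  fixes V :: "'a set" and E :: "'a set set"
  assumes "graph_on V E"
    and "(\<lambda>n. real (ex_K3 V E n)) \<in> o(\<lambda>n. real n ^ 2)"
  shows "threshold V E \<le> (chromatic_number V E - 1) * (card V - 1) + 1"
  unfolding threshold_def
proof (intro Least_le allI impI)
  fix r assume r: "(chromatic_number V E - 1) * (card V - 1) + 1 \<le> r"
  have finV: "finite V" using assms(1) by (simp add: graph_on_def)
  show "(\<lambda>n. real (ex_berge V E r n)) \<in> o(\<lambda>n. real n ^ 2)"
  proof (cases "E = {}")
    case True
    then show ?thesis using ex_berge_smallo_edgeless[OF finV] by simp
  next
    case False
    show ?thesis
    proof (cases "chromatic_number V E = 2")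
      case True
      then have "card V \<le> r" using r by simp
      then show ?thesis by (rule ex_berge_smallo_bipartite[OF assms(1) False True])
    next
      case not2: False
      \<comment> \<open>Chromatic number at least 3 is what makes the bound exceed twice the maximal
        size of a heavy clique.\<close>
      then have "2 \<le> chromatic_number V E - 1" using chromatic_number_ge_2[OF assms(1) False] by linarith
      then have "2 * (card V - 1) \<le> (chromatic_number V E - 1) * (card V - 1)" by (rule mult_right_mono) simp
      then have "2 * (card V - 1) < r" using r by linarith
      then show ?thesis by (rule ex_berge_smallo_nonbipartite[OF assms(1) False assms(2)])
    qed
  qed
qed

end
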